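(* Let $X$ be a Gromov manifold and let $\Omega\subset X$ be a domain with smooth boundary $\partial\Omega$ oriented by the outward-pointing normal. Then $\partial\Omega$ is Lagrangian convex if and only if its second fundamental form satisfies $$\mathrm{tr}_W II\le0$$ for all Lagrangian planes $W$ which are tangent to $\partial\Omega$, i.e. for all $W\in LAG(\partial\Omega)$. (This can be expressed more geometrically by saying that $\mathrm{tr}_WB$ must be inward-pointing for all $W\in LAG(\partial\Omega)$, where $B_{v,w}\equiv(\nabla_v\widetilde w)^{\mathrm{Nor}}$ is the normal-vector valued second fundamental form.) Furthermore, $\partial\Omega$ is strictly Lagrangian convex if and only if $$\mathrm{tr}_W II<0\qquad\forall\,W\in LAG(\partial\Omega),$$ or equivalently, $\mathrm{tr}_WB$ is non-zero and inward-pointing for all $W\in LAG(\partial\Omega)$.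
   Context: A Gromov manifold is a triple $(X,\omega,J)$ where $(X,\omega)$ is a symplectic manifold of real dimension $2n$ and $J$ is an almost complex structure with $\omega(v,w)=\omega(Jv,Jw)$ and $\omega(Jv,v)>0$ for all non-zero tangent vectors. It carries the riemannian metric $\langle v,w\rangle=\omega(Jv,w)$, with Levi-Civita connection $\nabla$ and riemannian Hessian $(\mathrm{Hess}\,f)(v,w)=vwf-(\nabla_vw)f$. In this part of the paper $X$ is non-compact and $\Omega$ is relatively compact in $X$. An $n$-plane $W\subset T_xX$ is Lagrangian if $\omega|_W=0$; $LAG(\partial\Omega)$ is the set of all Lagrangian $n$-planes $W\subset T_x\partial\Omega$, $x\in\partial\Omega$. $\mathrm{tr}_W$ denotes the trace of a bilinear form restricted to $W$. A defining function for $\partial\Omega$ is a smooth function $\rho$ on a neighborhood of $\overline\Omega$ with $\Omega=\{\rho<0\}$ and $\nabla\rho\ne0$ on $\partial\Omega$. $\partial\Omega$ is Lagrangian convex (resp. strictly Lagrangian convex) if $\mathrm{tr}_W\mathrm{Hess}\rho\ge0$ (resp. $>0$) for all $W\in LAG(\partial\Omega)$; this is independent of the choice of $\rho$. With $n$ the outward unit normal, $II(v,w)=\langle\nabla_v\widetilde w,n\rangle$ for $v,w\in T_x\partial\Omega$, where $\widetilde w$ is any extension of $w$ to a tangent vector field on $\partial\Omega$; $(\cdot)^{\mathrm{Nor}}$ is the component normal to $\partial\Omega$. "Inward-pointing" in the non-strict statement allows zero. *)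

theory Defs
  imports "HOL-Analysis.Analysis"
begin

section \<open>Smooth manifolds\<close>

text \<open>All sets \<open>S\<close> below are open, so that \<open>Ck_on k S\<close> is the usual class of \<open>k\<close> times
  continuously differentiable maps.\<close>

primrec Ck_on :: "nat \<Rightarrow> 'a::euclidean_space set \<Rightarrow> ('a \<Rightarrow> 'b::real_normed_vector) \<Rightarrow> bool" where
  "Ck_on 0 S f \<longleftrightarrow> continuous_on S f"
| "Ck_on (Suc k) S f \<longleftrightarrow> (\<forall>x\<in>S. f differentiable (at x)) \<and>
     (\<forall>v. Ck_on k S (\<lambda>x. frechet_derivative f (at x) v))"

definition Cinf_on :: "'a::euclidean_space set \<Rightarrow> ('a \<Rightarrow> 'b::real_normed_vector) \<Rightarrow> bool" where
  "Cinf_on S f \<longleftrightarrow> (\<forall>k. Ck_on k S f)"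

text \<open>The manifold is the whole (Hausdorff, second countable) type \<open>'x\<close>; a chart is a pair
  of its domain and its coordinate map into the model space \<open>'e\<close>.\<close>

type_synonym ('x, 'e) atlas = "('x set \<times> ('x \<Rightarrow> 'e)) set"

definition smooth_atlas ::
  "('x::{t2_space,second_countable_topology}, 'e::euclidean_space) atlas \<Rightarrow> bool" where
  "smooth_atlas A \<longleftrightarrow>
     (\<Union>(D, \<phi>)\<in>A. D) = UNIV \<and>
     (\<forall>(D, \<phi>)\<in>A. open D \<and> open (\<phi> ` D) \<and> (\<exists>\<psi>. homeomorphism D (\<phi> ` D) \<phi> \<psi>)) \<and>
     (\<forall>(D, \<phi>)\<in>A. \<forall>(E, \<psi>)\<in>A. Cinf_on (\<phi> ` (D \<inter> E)) (\<psi> \<circ> inv_into D \<phi>))"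

definition fun_smooth ::
  "('x::topological_space, 'e::euclidean_space) atlas \<Rightarrow> 'x set \<Rightarrow> ('x \<Rightarrow> real) \<Rightarrow> bool" where
  "fun_smooth A U f \<longleftrightarrow> (\<forall>(D, \<phi>)\<in>A. Cinf_on (\<phi> ` (U \<inter> D)) (f \<circ> inv_into D \<phi>))"

text \<open>Every tangent space is a copy of the model space: a vector \<open>v :: 'e\<close>, regarded as a
  tangent vector at \<open>x\<close>, has components \<open>v\<close> in the chart \<open>chart_at A x\<close>, which is chosen
  once and for all. The choice need not depend continuously on \<open>x\<close>; smoothness of vector
  fields is therefore expressed through their action on smooth functions.
  \<open>dir A x v f\<close> is the derivative \<open>v f\<close> of \<open>f\<close> in the direction of \<open>v\<close> at \<open>x\<close>.\<close>

definition chart_at :: "('x, 'e) atlas \<Rightarrow> 'x \<Rightarrow> 'x set \<times> ('x \<Rightarrow> 'e)" where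
  "chart_at A x = (SOME c. c \<in> A \<and> x \<in> fst c)"

definition dir ::
  "('x, 'e::euclidean_space) atlas \<Rightarrow> 'x \<Rightarrow> 'e \<Rightarrow> ('x \<Rightarrow> real) \<Rightarrow> real" where
  "dir A x v f = (case chart_at A x of (D, \<phi>) \<Rightarrow>
     frechet_derivative (f \<circ> inv_into D \<phi>) (at (\<phi> x)) v)"

definition vf_smooth ::
  "('x::topological_space, 'e::euclidean_space) atlas \<Rightarrow> 'x set \<Rightarrow> ('x \<Rightarrow> 'e) \<Rightarrow> bool" where
  "vf_smooth A U V \<longleftrightarrow> (\<forall>U' f. open U' \<longrightarrow> U' \<subseteq> U \<longrightarrow> fun_smooth A U' f \<longrightarrow>
     fun_smooth A U' (\<lambda>y. dir A y (V y) f))"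

definition lie_bracket ::
  "('x::topological_space, 'e::euclidean_space) atlas \<Rightarrow> ('x \<Rightarrow> 'e) \<Rightarrow> ('x \<Rightarrow> 'e) \<Rightarrow> 'x \<Rightarrow> 'e" where
  "lie_bracket A V W x = (THE u. \<forall>U f. open U \<longrightarrow> x \<in> U \<longrightarrow> fun_smooth A U f \<longrightarrow>
     dir A x u f = dir A x (V x) (\<lambda>y. dir A y (W y) f) - dir A x (W x) (\<lambda>y. dir A y (V y) f))"

section \<open>Gromov manifolds\<close>

definition symplectic_form ::
  "('x::topological_space, 'e::euclidean_space) atlas \<Rightarrow> ('x \<Rightarrow> 'e \<Rightarrow> 'e \<Rightarrow> real) \<Rightarrow> bool" where
  "symplectic_form A \<omega> \<longleftrightarrow>
     (\<forall>x. bilinear (\<omega> x) \<and> (\<forall>v. \<omega> x v v = 0) \<and> (\<forall>v. v \<noteq> 0 \<longrightarrow> (\<exists>w. \<omega> x v w \<noteq> 0))) \<and>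
     (\<forall>U V W. open U \<longrightarrow> vf_smooth A U V \<longrightarrow> vf_smooth A U W \<longrightarrow>
        fun_smooth A U (\<lambda>y. \<omega> y (V y) (W y))) \<and>
     \<comment> \<open>\<open>d\<omega> = 0\<close>\<close>
     (\<forall>U V1 V2 V3 x. open U \<longrightarrow> x \<in> U \<longrightarrow>
        vf_smooth A U V1 \<longrightarrow> vf_smooth A U V2 \<longrightarrow> vf_smooth A U V3 \<longrightarrow>
          dir A x (V1 x) (\<lambda>y. \<omega> y (V2 y) (V3 y))
        - dir A x (V2 x) (\<lambda>y. \<omega> y (V1 y) (V3 y))
        + dir A x (V3 x) (\<lambda>y. \<omega> y (V1 y) (V2 y))
        - \<omega> x (lie_bracket A V1 V2 x) (V3 x)
        + \<omega> x (lie_bracket A V1 V3 x) (V2 x)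
        - \<omega> x (lie_bracket A V2 V3 x) (V1 x) = 0)"

definition almost_complex ::
  "('x::topological_space, 'e::euclidean_space) atlas \<Rightarrow> ('x \<Rightarrow> 'e \<Rightarrow> 'e) \<Rightarrow> bool" where
  "almost_complex A J \<longleftrightarrow>
     (\<forall>x. linear (J x) \<and> (\<forall>v. J x (J x v) = - v)) \<and>
     (\<forall>U V. open U \<longrightarrow> vf_smooth A U V \<longrightarrow> vf_smooth A U (\<lambda>y. J y (V y)))"

definition gromov_manifold ::
  "('x::{t2_space,second_countable_topology}, 'e::euclidean_space) atlas \<Rightarrow>
   ('x \<Rightarrow> 'e \<Rightarrow> 'e \<Rightarrow> real) \<Rightarrow> ('x \<Rightarrow> 'e \<Rightarrow> 'e) \<Rightarrow> bool" where
  "gromov_manifold A \<omega> J \<longleftrightarrow>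
     smooth_atlas A \<and> symplectic_form A \<omega> \<and> almost_complex A J \<and>
     (\<forall>x v w. \<omega> x v w = \<omega> x (J x v) (J x w)) \<and>
     (\<forall>x v. v \<noteq> 0 \<longrightarrow> \<omega> x (J x v) v > 0)"

definition gromov_metric ::
  "('x \<Rightarrow> 'e \<Rightarrow> 'e \<Rightarrow> real) \<Rightarrow> ('x \<Rightarrow> 'e \<Rightarrow> 'e) \<Rightarrow> 'x \<Rightarrow> 'e \<Rightarrow> 'e \<Rightarrow> real" where
  "gromov_metric \<omega> J x v w = \<omega> x (J x v) w"

section \<open>Riemannian geometry\<close>

definition gradient ::
  "('x, 'e::euclidean_space) atlas \<Rightarrow> ('x \<Rightarrow> 'e \<Rightarrow> 'e \<Rightarrow> real) \<Rightarrow> ('x \<Rightarrow> real) \<Rightarrow> 'x \<Rightarrow> 'e" where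
  "gradient A g f x = (THE u. \<forall>v. g x u v = dir A x v f)"

text \<open>A connection is written \<open>nabla x v W\<close> for \<open>\<nabla>\<^sub>v W\<close> with \<open>v\<close> a tangent vector at \<open>x\<close> and
  \<open>W\<close> a vector field defined near \<open>x\<close>. Fields are total functions, so that the values of
  \<open>W\<close> outside its domain must be irrelevant (second clause).\<close>

definition affine_connection ::
  "('x::topological_space, 'e::euclidean_space) atlas \<Rightarrow> ('x \<Rightarrow> 'e \<Rightarrow> ('x \<Rightarrow> 'e) \<Rightarrow> 'e) \<Rightarrow> bool" where
  "affine_connection A nabla \<longleftrightarrow>
     (\<forall>U W x. open U \<longrightarrow> x \<in> U \<longrightarrow> vf_smooth A U W \<longrightarrow> linear (\<lambda>v. nabla x v W)) \<and>
     (\<forall>U W W' x v. open U \<longrightarrow> x \<in> U \<longrightarrow> vf_smooth A U W \<longrightarrow> vf_smooth A U W' \<longrightarrow>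
        (\<forall>y\<in>U. W y = W' y) \<longrightarrow> nabla x v W = nabla x v W') \<and>
     (\<forall>U W W' x v. open U \<longrightarrow> x \<in> U \<longrightarrow> vf_smooth A U W \<longrightarrow> vf_smooth A U W' \<longrightarrow>
        nabla x v (\<lambda>y. W y + W' y) = nabla x v W + nabla x v W') \<and>
     (\<forall>U f W x v. open U \<longrightarrow> x \<in> U \<longrightarrow> fun_smooth A U f \<longrightarrow> vf_smooth A U W \<longrightarrow>
        nabla x v (\<lambda>y. f y *\<^sub>R W y) = dir A x v f *\<^sub>R W x + f x *\<^sub>R nabla x v W) \<and>
     (\<forall>U V W. open U \<longrightarrow> vf_smooth A U V \<longrightarrow> vf_smooth A U W \<longrightarrow>
        vf_smooth A U (\<lambda>y. nabla y (V y) W))"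

definition levi_civita ::
  "('x::topological_space, 'e::euclidean_space) atlas \<Rightarrow> ('x \<Rightarrow> 'e \<Rightarrow> 'e \<Rightarrow> real) \<Rightarrow>
   ('x \<Rightarrow> 'e \<Rightarrow> ('x \<Rightarrow> 'e) \<Rightarrow> 'e) \<Rightarrow> bool" where
  "levi_civita A g nabla \<longleftrightarrow>
     affine_connection A nabla \<and>
     (\<forall>U V W x. open U \<longrightarrow> x \<in> U \<longrightarrow> vf_smooth A U V \<longrightarrow> vf_smooth A U W \<longrightarrow>
        nabla x (V x) W - nabla x (W x) V = lie_bracket A V W x) \<and>
     (\<forall>U W Z x v. open U \<longrightarrow> x \<in> U \<longrightarrow> vf_smooth A U W \<longrightarrow> vf_smooth A U Z \<longrightarrow>
        dir A x v (\<lambda>y. g y (W y) (Z y)) = g x (nabla x v W) (Z x) + g x (W x) (nabla x v Z))"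

text \<open>\<open>(Hess f)(v,w) = v w f - (\<nabla>\<^sub>v w) f\<close>. To evaluate it on a single tangent vector \<open>w\<close> at
  \<open>x\<close>, \<open>w\<close> is extended to a vector field near \<open>x\<close>; the value does not depend on the
  extension.\<close>

definition hess ::
  "('x::topological_space, 'e::euclidean_space) atlas \<Rightarrow> ('x \<Rightarrow> 'e \<Rightarrow> ('x \<Rightarrow> 'e) \<Rightarrow> 'e) \<Rightarrow>
   ('x \<Rightarrow> real) \<Rightarrow> 'x \<Rightarrow> 'e \<Rightarrow> 'e \<Rightarrow> real" where
  "hess A nabla f x v w =
     (let W = (SOME W. (\<exists>U. open U \<and> x \<in> U \<and> vf_smooth A U W) \<and> W x = w)
      in dir A x v (\<lambda>y. dir A y (W y) f) - dir A x (nabla x v W) f)"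

text \<open>The trace on a subspace \<open>W\<close> of a (possibly vector valued) bilinear map \<open>b\<close>, with
  respect to the inner product \<open>h\<close>.\<close>

definition metric_trace ::
  "('e::euclidean_space \<Rightarrow> 'e \<Rightarrow> real) \<Rightarrow> 'e set \<Rightarrow> ('e \<Rightarrow> 'e \<Rightarrow> 'b::real_vector) \<Rightarrow> 'b" where
  "metric_trace h W b =
     (let E = (SOME E. finite E \<and> span E = W \<and>
                 (\<forall>e\<in>E. \<forall>e'\<in>E. h e e' = (if e = e' then 1 else 0)))
      in \<Sum>e\<in>E. b e e)"

section \<open>Domains with smooth boundary\<close>

definition local_defining_function ::
  "('x::topological_space, 'e::euclidean_space) atlas \<Rightarrow> 'x set \<Rightarrow> 'x set \<Rightarrow> ('x \<Rightarrow> real) \<Rightarrow> bool" where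
  "local_defining_function A \<Omega> U r \<longleftrightarrow>
     open U \<and> fun_smooth A U r \<and> \<Omega> \<inter> U = {y\<in>U. r y < 0} \<and>
     (\<forall>y\<in>frontier \<Omega> \<inter> U. \<exists>v. dir A y v r \<noteq> 0)"

definition smooth_boundary ::
  "('x::topological_space, 'e::euclidean_space) atlas \<Rightarrow> 'x set \<Rightarrow> bool" where
  "smooth_boundary A \<Omega> \<longleftrightarrow>
     (\<forall>x\<in>frontier \<Omega>. \<exists>U r. x \<in> U \<and> local_defining_function A \<Omega> U r)"

definition defining_function ::
  "('x::topological_space, 'e::euclidean_space) atlas \<Rightarrow> ('x \<Rightarrow> 'e \<Rightarrow> 'e \<Rightarrow> real) \<Rightarrow>
   'x set \<Rightarrow> ('x \<Rightarrow> real) \<Rightarrow> bool" where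
  "defining_function A g \<Omega> \<rho> \<longleftrightarrow>
     (\<exists>U. open U \<and> closure \<Omega> \<subseteq> U \<and> fun_smooth A U \<rho> \<and> \<Omega> = {y\<in>U. \<rho> y < 0} \<and>
        (\<forall>y\<in>frontier \<Omega>. gradient A g \<rho> y \<noteq> 0))"

text \<open>The tangent space at \<open>x\<close> of an embedded submanifold \<open>S\<close>: the tangent vectors
  annihilating all smooth functions near \<open>x\<close> that vanish on \<open>S\<close>.\<close>

definition tangent_to ::
  "('x::topological_space, 'e::euclidean_space) atlas \<Rightarrow> 'x set \<Rightarrow> 'x \<Rightarrow> 'e set" where
  "tangent_to A S x = {v. \<forall>U f. open U \<longrightarrow> x \<in> U \<longrightarrow> fun_smooth A U f \<longrightarrow>
     (\<forall>y\<in>U \<inter> S. f y = 0) \<longrightarrow> dir A x v f = 0}"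

definition outward_normal ::
  "('x::topological_space, 'e::euclidean_space) atlas \<Rightarrow> ('x \<Rightarrow> 'e \<Rightarrow> 'e \<Rightarrow> real) \<Rightarrow>
   'x set \<Rightarrow> 'x \<Rightarrow> 'e" where
  "outward_normal A g \<Omega> x = (THE N. g x N N = 1 \<and>
     (\<forall>v\<in>tangent_to A (frontier \<Omega>) x. g x N v = 0) \<and>
     (\<exists>U r. x \<in> U \<and> local_defining_function A \<Omega> U r \<and> dir A x N r > 0))"

definition normal_part ::
  "('x::topological_space, 'e::euclidean_space) atlas \<Rightarrow> ('x \<Rightarrow> 'e \<Rightarrow> 'e \<Rightarrow> real) \<Rightarrow>
   'x set \<Rightarrow> 'x \<Rightarrow> 'e \<Rightarrow> 'e" where
  "normal_part A g \<Omega> x u = (THE \<nu>. (\<forall>v\<in>tangent_to A (frontier \<Omega>) x. g x \<nu> v = 0) \<and>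
     u - \<nu> \<in> tangent_to A (frontier \<Omega>) x)"

text \<open>Vector fields tangent to the boundary are represented by vector fields on a
  neighbourhood of \<open>x\<close> that are tangent to the boundary at its points; for \<open>v\<close> tangent to the
  boundary \<open>\<nabla>\<^sub>v\<close> of such a field only depends on its restriction to the boundary.\<close>

definition tangential_extension ::
  "('x::topological_space, 'e::euclidean_space) atlas \<Rightarrow> 'x set \<Rightarrow> 'x \<Rightarrow> 'e \<Rightarrow> ('x \<Rightarrow> 'e)" where
  "tangential_extension A \<Omega> x w = (SOME W.
     (\<exists>U. open U \<and> x \<in> U \<and> vf_smooth A U W \<and>
        (\<forall>y\<in>U \<inter> frontier \<Omega>. W y \<in> tangent_to A (frontier \<Omega>) y)) \<and> W x = w)"

definition second_fund ::
  "('x::topological_space, 'e::euclidean_space) atlas \<Rightarrow> ('x \<Rightarrow> 'e \<Rightarrow> 'e \<Rightarrow> real) \<Rightarrow>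
   ('x \<Rightarrow> 'e \<Rightarrow> ('x \<Rightarrow> 'e) \<Rightarrow> 'e) \<Rightarrow> 'x set \<Rightarrow> 'x \<Rightarrow> 'e \<Rightarrow> 'e \<Rightarrow> real" where
  "second_fund A g nabla \<Omega> x v w =
     g x (nabla x v (tangential_extension A \<Omega> x w)) (outward_normal A g \<Omega> x)"

definition second_fund_vec ::
  "('x::topological_space, 'e::euclidean_space) atlas \<Rightarrow> ('x \<Rightarrow> 'e \<Rightarrow> 'e \<Rightarrow> real) \<Rightarrow>
   ('x \<Rightarrow> 'e \<Rightarrow> ('x \<Rightarrow> 'e) \<Rightarrow> 'e) \<Rightarrow> 'x set \<Rightarrow> 'x \<Rightarrow> 'e \<Rightarrow> 'e \<Rightarrow> 'e" where
  "second_fund_vec A g nabla \<Omega> x v w =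
     normal_part A g \<Omega> x (nabla x v (tangential_extension A \<Omega> x w))"

text \<open>For normal vectors; zero counts as inward-pointing.\<close>

definition inward_pointing ::
  "('x::topological_space, 'e::euclidean_space) atlas \<Rightarrow> ('x \<Rightarrow> 'e \<Rightarrow> 'e \<Rightarrow> real) \<Rightarrow>
   'x set \<Rightarrow> 'x \<Rightarrow> 'e \<Rightarrow> bool" where
  "inward_pointing A g \<Omega> x \<nu> \<longleftrightarrow> (\<exists>c\<ge>0. \<nu> = c *\<^sub>R (- outward_normal A g \<Omega> x))"

section \<open>Lagrangian convexity\<close>

definition lagrangian_plane ::
  "('x \<Rightarrow> 'e::euclidean_space \<Rightarrow> 'e \<Rightarrow> real) \<Rightarrow> nat \<Rightarrow> 'x \<Rightarrow> 'e set \<Rightarrow> bool" where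
  "lagrangian_plane \<omega> n x W \<longleftrightarrow> subspace W \<and> dim W = n \<and> (\<forall>v\<in>W. \<forall>w\<in>W. \<omega> x v w = 0)"

definition LAG ::
  "('x::topological_space, 'e::euclidean_space) atlas \<Rightarrow> ('x \<Rightarrow> 'e \<Rightarrow> 'e \<Rightarrow> real) \<Rightarrow> nat \<Rightarrow>
   'x set \<Rightarrow> ('x \<times> 'e set) set" where
  "LAG A \<omega> n \<Omega> = {(x, W). x \<in> frontier \<Omega> \<and> lagrangian_plane \<omega> n x W \<and>
     W \<subseteq> tangent_to A (frontier \<Omega>) x}"

text \<open>In the next two definitions \<open>\<rho>\<close> is some, equivalently any, defining function.\<close>

definition lagrangian_convex ::
  "('x::topological_space, 'e::euclidean_space) atlas \<Rightarrow> ('x \<Rightarrow> 'e \<Rightarrow> 'e \<Rightarrow> real) \<Rightarrow>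
   ('x \<Rightarrow> 'e \<Rightarrow> 'e) \<Rightarrow> ('x \<Rightarrow> 'e \<Rightarrow> ('x \<Rightarrow> 'e) \<Rightarrow> 'e) \<Rightarrow> nat \<Rightarrow> 'x set \<Rightarrow> bool" where
  "lagrangian_convex A \<omega> J nabla n \<Omega> \<longleftrightarrow>
     (\<exists>\<rho>. defining_function A (gromov_metric \<omega> J) \<Omega> \<rho> \<and>
        (\<forall>(x, W)\<in>LAG A \<omega> n \<Omega>. metric_trace (gromov_metric \<omega> J x) W (hess A nabla \<rho> x) \<ge> 0))"

definition strictly_lagrangian_convex ::
  "('x::topological_space, 'e::euclidean_space) atlas \<Rightarrow> ('x \<Rightarrow> 'e \<Rightarrow> 'e \<Rightarrow> real) \<Rightarrow>
   ('x \<Rightarrow> 'e \<Rightarrow> 'e) \<Rightarrow> ('x \<Rightarrow> 'e \<Rightarrow> ('x \<Rightarrow> 'e) \<Rightarrow> 'e) \<Rightarrow> nat \<Rightarrow> 'x set \<Rightarrow> bool" where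
  "strictly_lagrangian_convex A \<omega> J nabla n \<Omega> \<longleftrightarrow>
     (\<exists>\<rho>. defining_function A (gromov_metric \<omega> J) \<Omega> \<rho> \<and>
        (\<forall>(x, W)\<in>LAG A \<omega> n \<Omega>. metric_trace (gromov_metric \<omega> J x) W (hess A nabla \<rho> x) > 0))"

end

theory Submission
  imports Defs
begin

text \<open>Let \<open>V\<close> be a vector field near a boundary point \<open>x\<close> that is tangent to the boundary. Then
  \<open>V \<rho>\<close> vanishes on the boundary, hence \<open>v (V \<rho>) = 0\<close> for \<open>v\<close> tangent to it, and
  \<open>(Hess \<rho>)(v,V) = - (\<nabla>\<^sub>v V) \<rho> = - |\<nabla>\<rho>| II(v,V)\<close>; by the Leibniz rule the left hand side depends
  on \<open>V\<close> only through its value at \<open>x\<close>. Taking traces gives the equivalence for every defining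
  function \<open>\<rho>\<close>, and since the vector valued form is \<open>II\<close> times the outward normal, also the
  geometric version. A global defining function exists because local ones can be glued over the compact
  closure of the domain.\<close>

section \<open>Smooth functions on open sets\<close>

text \<open>Two features of the encoding shape the work. Tangent vectors are coordinates in the
  chart \<open>chart_at A x\<close>, which may jump with \<open>x\<close>, so a vector field is
  accessible only through its action on functions; the fields \<open>coord_field\<close> turn this
  action into ordinary calculus in one fixed chart. Moreover, \<open>tangent_to\<close>,
  \<open>outward_normal\<close>, \<open>normal_part\<close> and \<open>hess\<close> quantify over
  functions or rest on choice operators, so each of them has to be evaluated before any geometry can
  start. For a local defining function \<open>r\<close> the tangent space turns out to be the kernel
  of the differential of \<open>r\<close>, and the normal is the normalized gradient of
  \<open>r\<close>. Its sign is well determined because all local defining functions agree about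
  which directions point outward.

  Convexity asks for some defining function. Passing from convexity to the second fundamental form
  therefore requires the comparison of signs for every \<open>\<rho>\<close>, whereas the way back
  requires one \<open>\<rho>\<close> to exist.\<close>

lemma Ck_on_cong:
  assumes "open S" "\<And>x. x \<in> S \<Longrightarrow> f x = g x"
  shows "Ck_on k S f \<longleftrightarrow> Ck_on k S g"
  using assms(2)
proof (induction k arbitrary: f g)
  case 0
  then show ?case by (auto intro: continuous_on_cong)
next
  case (Suc k)
  have diff: "f differentiable (at x) \<longleftrightarrow> g differentiable (at x)" if "x \<in> S" for x
    using has_derivative_transform_within_open[OF _ assms(1) that] Suc.prems
    unfolding differentiable_def by (metis (no_types, lifting))
  have eq: "frechet_derivative f (at x) v = frechet_derivative g (at x) v"
    if "x \<in> S" "f differentiable (at x)" for x v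
    using frechet_derivative_transform_within_open[OF that(2) assms(1) that(1)] Suc.prems
    by simp
  show ?case
  proof
    assume L: "Ck_on (Suc k) S f"
    then have d: "\<And>x. x \<in> S \<Longrightarrow> f differentiable (at x)" by simp
    have "Ck_on k S (\<lambda>x. frechet_derivative g (at x) v)" for v
      using L Suc.IH[of "\<lambda>x. frechet_derivative f (at x) v" "\<lambda>x. frechet_derivative g (at x) v"] eq d
      by simp
    then show "Ck_on (Suc k) S g" using d diff by simp
  next
    assume R: "Ck_on (Suc k) S g"
    then have d: "\<And>x. x \<in> S \<Longrightarrow> f differentiable (at x)" using diff by simp
    have "Ck_on k S (\<lambda>x. frechet_derivative f (at x) v)" for v
      using R Suc.IH[of "\<lambda>x. frechet_derivative f (at x) v" "\<lambda>x. frechet_derivative g (at x) v"] eq d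
      by simp
    then show "Ck_on (Suc k) S f" using d by simp
  qed
qed

lemma Ck_on_subset: "Ck_on k S f \<Longrightarrow> T \<subseteq> S \<Longrightarrow> Ck_on k T f"
  by (induction k arbitrary: f) (auto intro: continuous_on_subset)

lemma Ck_on_local:
  assumes "\<And>x. x \<in> S \<Longrightarrow> \<exists>T. open T \<and> x \<in> T \<and> Ck_on k T f"
  shows "Ck_on k S f"
  using assms
proof (induction k arbitrary: f)
  case 0
  then show ?case
    by (metis Ck_on.simps(1) continuous_at_imp_continuous_on continuous_on_eq_continuous_at)
next
  case (Suc k)
  have "f differentiable (at x)" if "x \<in> S" for x
    using Suc.prems[OF that] by auto
  moreover have "Ck_on k S (\<lambda>x. frechet_derivative f (at x) v)" for v
  proof (rule Suc.IH)
    fix x assume "x \<in> S"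
    then show "\<exists>T. open T \<and> x \<in> T \<and> Ck_on k T (\<lambda>x. frechet_derivative f (at x) v)"
      using Suc.prems[of x] by auto
  qed
  ultimately show ?case by simp
qed

text \<open>At the bottom of the recursion this is continuity of differentiable maps. It serves the
  product and chain rules, where undifferentiated factors appear next to derivatives.\<close>

lemma Ck_on_Suc_imp: "Ck_on (Suc k) S f \<Longrightarrow> Ck_on k S f"
proof (induction k arbitrary: f)
  case 0
  then show ?case
    by (auto intro!: continuous_at_imp_continuous_on differentiable_imp_continuous_within)
qed auto

lemma Ck_on_const: "Ck_on k S (\<lambda>x. c)"
  by (induction k arbitrary: c) (auto simp: frechet_derivative_const)

text \<open>The induction step of all closure properties below: any explicit formula
  \<open>f'\<close> for the derivative may replace \<open>frechet_derivative\<close>, because the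
  two agree on the open set \<open>S\<close>.\<close>

lemma Ck_on_Suc_I:
  assumes "\<And>x. x \<in> S \<Longrightarrow> (f has_derivative f' x) (at x)" "open S"
    and "\<And>v. Ck_on k S (\<lambda>x. f' x v)"
  shows "Ck_on (Suc k) S f"
proof -
  have "frechet_derivative f (at x) = f' x" if "x \<in> S" for x
    using frechet_derivative_at[OF assms(1)[OF that]] by simp
  then have "Ck_on k S (\<lambda>x. frechet_derivative f (at x) v)" for v
    using Ck_on_cong[OF assms(2), of "\<lambda>x. frechet_derivative f (at x) v" "\<lambda>x. f' x v"] assms(3)
    by simp
  then show ?thesis using assms(1) by (auto simp: differentiable_def)
qed

lemma Ck_on_Suc_D:
  assumes "Ck_on (Suc k) S f" "x \<in> S"
  shows "(f has_derivative frechet_derivative f (at x)) (at x)"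
  using assms by (simp add: frechet_derivative_works[symmetric])

lemma Ck_on_bounded_linear:
  assumes "open S" "bounded_linear L" "Ck_on k S f"
  shows "Ck_on k S (\<lambda>x. L (f x))"
  using assms(3)
proof (induction k arbitrary: f)
  case 0
  then show ?case by (auto intro: bounded_linear.continuous_on[OF assms(2)])
next
  case (Suc k)
  show ?case
    using Ck_on_Suc_D[OF Suc.prems] Suc
    by (intro Ck_on_Suc_I[where f' = "\<lambda>x v. L (frechet_derivative f (at x) v)"])
      (auto intro: bounded_linear.has_derivative[OF assms(2)] assms)
qed

lemma Ck_on_add:
  assumes "open S" "Ck_on k S f" "Ck_on k S g"
  shows "Ck_on k S (\<lambda>x. f x + g x)"
  using assms(2,3)
proof (induction k arbitrary: f g)
  case 0
  then show ?case by (auto intro: continuous_intros)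
next
  case (Suc k)
  show ?case
    using Ck_on_Suc_D[OF Suc.prems(1)] Ck_on_Suc_D[OF Suc.prems(2)] Suc
    by (intro Ck_on_Suc_I[where f' = "\<lambda>x v. frechet_derivative f (at x) v + frechet_derivative g (at x) v"])
      (auto intro: has_derivative_add assms)
qed

lemma Ck_on_sum:
  assumes "open S" "\<And>i. i \<in> I \<Longrightarrow> Ck_on k S (f i)"
  shows "Ck_on k S (\<lambda>x. \<Sum>i\<in>I. f i x)"
  using assms(2)
  by (induction I rule: infinite_finite_induct) (auto intro: Ck_on_const Ck_on_add assms(1))

lemma Ck_on_bounded_bilinear:
  assumes "bounded_bilinear b" "open S" "Ck_on k S f" "Ck_on k S g"
  shows "Ck_on k S (\<lambda>x. b (f x) (g x))"
  using assms(3,4)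
proof (induction k arbitrary: f g)
  case 0
  then show ?case by (auto intro: bounded_bilinear.continuous_on[OF assms(1)])
next
  case (Suc k)
  let ?h' = "\<lambda>x v. b (f x) (frechet_derivative g (at x) v) + b (frechet_derivative f (at x) v) (g x)"
  have "Ck_on k S f" "Ck_on k S g"
    using Suc.prems by (auto intro: Ck_on_Suc_imp simp del: Ck_on.simps)
  then have "Ck_on k S (\<lambda>x. ?h' x v)" for v
    using Suc by (intro Ck_on_add assms(2) Suc.IH) auto
  moreover have "((\<lambda>x. b (f x) (g x)) has_derivative ?h' x) (at x)" if "x \<in> S" for x
    using bounded_bilinear.FDERIV[OF assms(1) Ck_on_Suc_D[OF Suc.prems(1) that] Ck_on_Suc_D[OF Suc.prems(2) that]] .
  ultimately show ?case by (intro Ck_on_Suc_I[where f' = ?h'] assms(2))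
qed

text \<open>In the chain rule the derivative of \<open>g\<close> is taken in the direction
  \<open>frechet_derivative f (at x) v\<close>, which varies with \<open>x\<close>, while
  \<open>Ck_on\<close> speaks of fixed directions. Expanding this direction in \<open>Basis\<close>
  gives a sum of products to which the induction hypothesis applies.\<close>

lemma Ck_on_compose:
  fixes f :: "'a::euclidean_space \<Rightarrow> 'b::euclidean_space"
  assumes "open S" "open T" "Ck_on k S f" "Ck_on k T g" "f ` S \<subseteq> T"
  shows "Ck_on k S (\<lambda>x. g (f x))"
  using assms(3,4)
proof (induction k arbitrary: g)
  case 0
  then show ?case using assms(5) by (auto intro: continuous_on_compose2)
next
  case (Suc k)
  let ?f' = "\<lambda>x v. \<Sum>i\<in>Basis. (frechet_derivative f (at x) v \<bullet> i) *\<^sub>R frechet_derivative g (at (f x)) i"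
  have "((\<lambda>x. g (f x)) has_derivative ?f' x) (at x)" if "x \<in> S" for x
  proof -
    have f: "(f has_derivative frechet_derivative f (at x)) (at x)"
      and g: "(g has_derivative frechet_derivative g (at (f x))) (at (f x))"
      using Ck_on_Suc_D Suc.prems that assms(5) by blast+
    have *: "frechet_derivative g (at (f x)) w = (\<Sum>i\<in>Basis. (w \<bullet> i) *\<^sub>R frechet_derivative g (at (f x)) i)" for w
    proof -
      have "linear (frechet_derivative g (at (f x)))" using g has_derivative_linear by blast
      then show ?thesis
        using linear_sum[of "frechet_derivative g (at (f x))" "\<lambda>i. (w \<bullet> i) *\<^sub>R i" Basis]
        by (simp add: linear_scale euclidean_representation)
    qed
    then show ?thesis using has_derivative_compose[OF f g] by (simp only: *[symmetric])
  qed
  moreover have "Ck_on k S (\<lambda>x. ?f' x v)" for v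
  proof (intro Ck_on_sum Ck_on_bounded_bilinear[OF bounded_bilinear_scaleR] assms(1))
    fix i :: 'b
    show "Ck_on k S (\<lambda>x. frechet_derivative f (at x) v \<bullet> i)"
      using Suc.prems(1) by (intro Ck_on_bounded_linear[OF assms(1) bounded_linear_inner_left]) simp
    show "Ck_on k S (\<lambda>x. frechet_derivative g (at (f x)) i)"
      using Suc.prems(2) by (intro Suc.IH[OF Ck_on_Suc_imp[OF Suc.prems(1)]]) simp
  qed
  ultimately show ?case by (rule Ck_on_Suc_I[OF _ assms(1)])
qed

lemma Cinf_on_transform:
  "open S \<Longrightarrow> Cinf_on S f \<Longrightarrow> (\<And>x. x \<in> S \<Longrightarrow> f x = g x) \<Longrightarrow> Cinf_on S g"
  unfolding Cinf_on_def using Ck_on_cong by blast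

lemma Cinf_on_subset: "Cinf_on S f \<Longrightarrow> T \<subseteq> S \<Longrightarrow> Cinf_on T f"
  unfolding Cinf_on_def using Ck_on_subset by blast

lemma Cinf_on_local:
  "(\<And>x. x \<in> S \<Longrightarrow> \<exists>T. open T \<and> x \<in> T \<and> Cinf_on T f) \<Longrightarrow> Cinf_on S f"
  unfolding Cinf_on_def using Ck_on_local by metis

lemma Cinf_on_has_derivative:
  "Cinf_on S f \<Longrightarrow> x \<in> S \<Longrightarrow> (f has_derivative frechet_derivative f (at x)) (at x)"
  unfolding Cinf_on_def using Ck_on_Suc_D by blast

lemma Cinf_on_frechet_derivative:
  "Cinf_on S f \<Longrightarrow> Cinf_on S (\<lambda>x. frechet_derivative f (at x) v)"
  unfolding Cinf_on_def using Ck_on.simps(2) by blast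

lemma Cinf_on_bounded_linear:
  "open S \<Longrightarrow> bounded_linear L \<Longrightarrow> Cinf_on S f \<Longrightarrow> Cinf_on S (\<lambda>x. L (f x))"
  unfolding Cinf_on_def using Ck_on_bounded_linear by blast

lemma Cinf_on_compose:
  fixes f :: "'a::euclidean_space \<Rightarrow> 'b::euclidean_space"
  shows "open S \<Longrightarrow> open T \<Longrightarrow> Cinf_on S f \<Longrightarrow> Cinf_on T g \<Longrightarrow> f ` S \<subseteq> T \<Longrightarrow> Cinf_on S (\<lambda>x. g (f x))"
  unfolding Cinf_on_def using Ck_on_compose by blast

lemma Cinf_on_const: "Cinf_on S (\<lambda>x. c)"
  by (simp add: Cinf_on_def Ck_on_const)

lemma Cinf_on_id: "open S \<Longrightarrow> Cinf_on S (\<lambda>x. x)"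
  unfolding Cinf_on_def
proof
  fix k assume "open S"
  then show "Ck_on k S (\<lambda>x. x)"
  proof (cases k)
    case (Suc j)
    with \<open>open S\<close> show ?thesis
      using Ck_on_Suc_I[of S "\<lambda>x. x" "\<lambda>x v. v" j] Ck_on_const by (auto simp del: Ck_on.simps)
  qed auto
qed

lemma Cinf_on_add: "open S \<Longrightarrow> Cinf_on S f \<Longrightarrow> Cinf_on S g \<Longrightarrow> Cinf_on S (\<lambda>x. f x + g x)"
  unfolding Cinf_on_def using Ck_on_add by blast

lemma Cinf_on_bounded_bilinear:
  "bounded_bilinear b \<Longrightarrow> open S \<Longrightarrow> Cinf_on S f \<Longrightarrow> Cinf_on S g \<Longrightarrow> Cinf_on S (\<lambda>x. b (f x) (g x))"
  unfolding Cinf_on_def using Ck_on_bounded_bilinear by blast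

text \<open>For \<open>n = 0\<close> this is the classical function exp(-1/t) that is flat at 0. The
  factor \<open>inverse t ^ n\<close> is included because the linear span of the whole family is
  closed under differentiation.\<close>

definition flat_exp :: "nat \<Rightarrow> real \<Rightarrow> real" where
  "flat_exp n t = (if t > 0 then inverse t ^ n * exp (- inverse t) else 0)"

lemma flat_exp_tendsto_0: "(flat_exp n \<longlongrightarrow> 0) (at 0)"
proof -
  have "((\<lambda>t. inverse t ^ n / exp (inverse t)) \<longlongrightarrow> 0) (at_right (0::real))"
    using filterlim_compose[OF tendsto_power_div_exp_0 filterlim_inverse_at_top_right] .
  moreover have "\<forall>\<^sub>F t in at_right 0. inverse t ^ n / exp (inverse t) = flat_exp n t"
    by (auto simp: eventually_at_filter flat_exp_def exp_minus field_simps)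
  ultimately have r: "(flat_exp n \<longlongrightarrow> 0) (at_right 0)"
    using Lim_transform_eventually by blast
  have "(flat_exp n \<longlongrightarrow> 0) (at_left 0)"
    by (rule Lim_transform_eventually[OF tendsto_const]) (auto simp: eventually_at_filter flat_exp_def)
  then show ?thesis using r filterlim_split_at by blast
qed

text \<open>Differentiating exp(-1/t) contributes two powers of 1/t and differentiating the power
  contributes one, whence the indices \<open>n + 2\<close> and \<open>n + 1\<close>.\<close>

lemma flat_exp_has_derivative:
  "(flat_exp n has_real_derivative flat_exp (n + 2) t - n * flat_exp (n + 1) t) (at t)"
proof (cases t "0::real" rule: linorder_cases)
  case less
  have "((\<lambda>t. 0) has_real_derivative 0) (at t)" by simp
  then have "(flat_exp n has_real_derivative 0) (at t)"
    by (rule has_field_derivative_transform_within_open[of _ _ _ "{..<0}"])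
      (use less in \<open>auto simp: flat_exp_def\<close>)
  then show ?thesis using less by (simp add: flat_exp_def)
next
  case equal
  \<comment> \<open>Dividing \<open>flat_exp n\<close> by its argument raises the index by one, so
    the difference quotient at 0 is again a member of the family and tends to 0.\<close>
  have "((\<lambda>h. (flat_exp n (0 + h) - flat_exp n 0) / h) \<longlongrightarrow> 0) (at 0)"
  proof (rule Lim_transform_eventually[OF flat_exp_tendsto_0[of "Suc n"]])
    show "\<forall>\<^sub>F t in at 0. flat_exp (Suc n) t = (flat_exp n (0 + t) - flat_exp n 0) / t"
      by (auto simp: eventually_at_filter flat_exp_def field_simps)
  qed
  then show ?thesis using equal by (simp add: DERIV_def flat_exp_def)
next
  case greater
  have "((\<lambda>t. inverse t ^ n * exp (- inverse t)) has_real_derivative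
      flat_exp (n + 2) t - n * flat_exp (n + 1) t) (at t)"
  proof -
    \<comment> \<open>Truncated subtraction makes the exponent \<open>0\<close> at
      \<open>m = 0\<close>, hence the separate value \<open>t\<close> there.\<close>
    have "t * t ^ (m - Suc 0) = (if m = 0 then t else t ^ m)" for m
      by (cases m) auto
    then show ?thesis
      using greater
      by (cases n) (auto intro!: derivative_eq_intros simp: flat_exp_def field_simps power2_eq_square)
  qed
  then show ?thesis
    by (rule has_field_derivative_transform_within_open[of _ _ _ "{0<..}"])
      (use greater in \<open>auto simp: flat_exp_def\<close>)
qed

lemma Cinf_on_flat_exp: "Cinf_on UNIV (flat_exp n)"
proof -
  have "Ck_on k UNIV (flat_exp n)" for k
  proof (induction k arbitrary: n)
    case 0
    show ?case
      using DERIV_isCont[OF flat_exp_has_derivative] by (auto intro!: continuous_at_imp_continuous_on)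
  next
    case (Suc k)
    have "Ck_on k UNIV (\<lambda>t. (flat_exp (n + 2) t + (- real n) * flat_exp (n + 1) t) * v)" for v
      using Suc
      by (intro Ck_on_bounded_bilinear[OF bounded_bilinear_mult] Ck_on_add Ck_on_const) auto
    then show ?case
      using flat_exp_has_derivative[of n]
      by (intro Ck_on_Suc_I[where f' = "\<lambda>t v. (flat_exp (n + 2) t + (- real n) * flat_exp (n + 1) t) * v"])
        (auto simp: has_field_derivative_def)
  qed
  then show ?thesis by (simp add: Cinf_on_def)
qed

section \<open>Charts, directional derivatives and vector fields\<close>

text \<open>The coordinate vector field of the chart \<open>(D, \<phi>)\<close> in direction
  \<open>b\<close>. A tangent vector at \<open>y\<close> is recorded in the preferred chart at
  \<open>y\<close>, so the constant vector \<open>b\<close> has to be transported by the derivative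
  of the transition map.\<close>

definition coord_field ::
  "('x, 'e::euclidean_space) atlas \<Rightarrow> 'x set \<Rightarrow> ('x \<Rightarrow> 'e) \<Rightarrow> 'e \<Rightarrow> 'x \<Rightarrow> 'e" where
  "coord_field A D \<phi> b y = (case chart_at A y of (E, \<psi>) \<Rightarrow>
     frechet_derivative (\<psi> \<circ> inv_into D \<phi>) (at (\<phi> y)) b)"

locale smooth_manifold =
  fixes A :: "('x::{t2_space,second_countable_topology}, 'e::euclidean_space) atlas"
  assumes smooth_atlas: "smooth_atlas A"
begin

text \<open>An atlas only guarantees some continuous inverse; it agrees with
  \<open>inv_into D \<phi>\<close> on the image, so the inverse used in all definitions inherits
  continuity.\<close>

lemma chart_homeomorphism:
  assumes "(D, \<phi>) \<in> A"
  shows "homeomorphism D (\<phi> ` D) \<phi> (inv_into D \<phi>)"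
proof -
  obtain \<psi> where h: "homeomorphism D (\<phi> ` D) \<phi> \<psi>"
    using smooth_atlas assms unfolding smooth_atlas_def by blast
  then have "inj_on \<phi> D" by (metis homeomorphism_def inj_on_inverseI)
  then have "inv_into D \<phi> z = \<psi> z" if "z \<in> \<phi> ` D" for z
    using h that unfolding homeomorphism_def by (metis f_inv_into_f inv_into_f_f inv_into_into)
  then show ?thesis using h by (metis homeomorphism_cong)
qed

lemma chart_open: "(D, \<phi>) \<in> A \<Longrightarrow> open D"
  using smooth_atlas unfolding smooth_atlas_def by blast

lemma chart_inj: "(D, \<phi>) \<in> A \<Longrightarrow> inj_on \<phi> D"
  using chart_homeomorphism unfolding homeomorphism_def by (metis inj_on_inverseI)

lemma chart_continuous: "(D, \<phi>) \<in> A \<Longrightarrow> continuous_on D \<phi>"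
  using chart_homeomorphism unfolding homeomorphism_def by blast

lemma chart_inv_continuous: "(D, \<phi>) \<in> A \<Longrightarrow> continuous_on (\<phi> ` D) (inv_into D \<phi>)"
  using chart_homeomorphism unfolding homeomorphism_def by blast

lemma chart_inv [simp]: "(D, \<phi>) \<in> A \<Longrightarrow> x \<in> D \<Longrightarrow> inv_into D \<phi> (\<phi> x) = x"
  using chart_inj inv_into_f_f by metis

lemma chart_image_open:
  assumes "(D, \<phi>) \<in> A" "open U"
  shows "open (\<phi> ` (U \<inter> D))"
proof -
  have "open (\<phi> ` D)" using smooth_atlas assms unfolding smooth_atlas_def by blast
  then have "open (\<phi> ` D \<inter> inv_into D \<phi> -` U)"
    using continuous_open_preimage chart_inv_continuous assms by blast
  also have "\<phi> ` D \<inter> inv_into D \<phi> -` U = \<phi> ` (U \<inter> D)" using assms(1) by auto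
  finally show ?thesis .
qed

lemma chart_image_open': "(D, \<phi>) \<in> A \<Longrightarrow> open (\<phi> ` D)"
  using chart_image_open[of D \<phi> UNIV] by simp

lemma transition_smooth:
  "(D, \<phi>) \<in> A \<Longrightarrow> (E, \<psi>) \<in> A \<Longrightarrow> Cinf_on (\<phi> ` (D \<inter> E)) (\<psi> \<circ> inv_into D \<phi>)"
  using smooth_atlas unfolding smooth_atlas_def by blast

lemma chart_at:
  obtains D \<phi> where "chart_at A x = (D, \<phi>)" "(D, \<phi>) \<in> A" "x \<in> D"
proof -
  have "(\<Union>(D, \<phi>)\<in>A. D) = UNIV" using smooth_atlas unfolding smooth_atlas_def by blast
  then have "x \<in> (\<Union>(D, \<phi>)\<in>A. D)" by simp
  then have "\<exists>c. c \<in> A \<and> x \<in> fst c" by auto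
  then have "chart_at A x \<in> A \<and> x \<in> fst (chart_at A x)"
    unfolding chart_at_def by (rule someI_ex)
  then show ?thesis using that[of "fst (chart_at A x)" "snd (chart_at A x)"] by simp
qed

lemma fun_smoothD:
  "fun_smooth A U f \<Longrightarrow> (D, \<phi>) \<in> A \<Longrightarrow> Cinf_on (\<phi> ` (U \<inter> D)) (f \<circ> inv_into D \<phi>)"
  unfolding fun_smooth_def by blast

lemma fun_smoothI:
  "(\<And>D \<phi>. (D, \<phi>) \<in> A \<Longrightarrow> Cinf_on (\<phi> ` (U \<inter> D)) (f \<circ> inv_into D \<phi>)) \<Longrightarrow> fun_smooth A U f"
  unfolding fun_smooth_def by blast

text \<open>In any other chart the function is its representation in \<open>(D, \<phi>)\<close>
  composed with a smooth transition map, so a single chart suffices.\<close>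

lemma fun_smooth_chartI:
  assumes D: "(D, \<phi>) \<in> A" and U: "open U" "U \<subseteq> D" and f: "Cinf_on (\<phi> ` U) (f \<circ> inv_into D \<phi>)"
  shows "fun_smooth A U f"
proof (rule fun_smoothI)
  fix E \<psi> assume E: "(E, \<psi>) \<in> A"
  have o: "open (\<psi> ` (U \<inter> E))" "open (\<phi> ` U)"
    using chart_image_open[OF E U(1)] chart_image_open[OF D U(1)] U(2) by (simp_all add: Int_absorb2)
  have "Cinf_on (\<psi> ` (U \<inter> E)) (\<phi> \<circ> inv_into E \<psi>)"
    by (rule Cinf_on_subset[OF transition_smooth[OF E D]]) (use U in blast)
  moreover have "(\<phi> \<circ> inv_into E \<psi>) ` \<psi> ` (U \<inter> E) \<subseteq> \<phi> ` U" using E by auto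
  ultimately have "Cinf_on (\<psi> ` (U \<inter> E)) (\<lambda>z. (f \<circ> inv_into D \<phi>) ((\<phi> \<circ> inv_into E \<psi>) z))"
    by (rule Cinf_on_compose[OF o _ f])
  moreover have "(f \<circ> inv_into D \<phi>) ((\<phi> \<circ> inv_into E \<psi>) z) = (f \<circ> inv_into E \<psi>) z"
    if "z \<in> \<psi> ` (U \<inter> E)" for z
    using that U D E by auto
  ultimately show "Cinf_on (\<psi> ` (U \<inter> E)) (f \<circ> inv_into E \<psi>)"
    by (rule Cinf_on_transform[OF o(1)])
qed

lemma fun_smooth_subset:
  assumes "fun_smooth A U f" "U' \<subseteq> U"
  shows "fun_smooth A U' f"
  by (rule fun_smoothI, rule Cinf_on_subset[OF fun_smoothD[OF assms(1)]]) (use assms(2) in auto)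

lemma fun_smooth_cong:
  assumes "open U" "\<And>y. y \<in> U \<Longrightarrow> f y = h y" "fun_smooth A U f"
  shows "fun_smooth A U h"
proof (rule fun_smoothI)
  fix D \<phi> assume D: "(D, \<phi>) \<in> A"
  show "Cinf_on (\<phi> ` (U \<inter> D)) (h \<circ> inv_into D \<phi>)"
    by (rule Cinf_on_transform[OF chart_image_open[OF D assms(1)] fun_smoothD[OF assms(3) D]])
      (use D assms(2) in auto)
qed

lemma fun_smooth_local:
  assumes "\<And>y. y \<in> U \<Longrightarrow> \<exists>U'. open U' \<and> y \<in> U' \<and> fun_smooth A U' f"
  shows "fun_smooth A U f"
proof (rule fun_smoothI)
  fix D \<phi> assume D: "(D, \<phi>) \<in> A"
  show "Cinf_on (\<phi> ` (U \<inter> D)) (f \<circ> inv_into D \<phi>)"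
  proof (rule Cinf_on_local)
    fix z assume "z \<in> \<phi> ` (U \<inter> D)"
    then obtain y where y: "y \<in> U" "y \<in> D" "z = \<phi> y" by blast
    obtain U' where "open U'" "y \<in> U'" "fun_smooth A U' f" using assms y by blast
    then show "\<exists>T. open T \<and> z \<in> T \<and> Cinf_on T (f \<circ> inv_into D \<phi>)"
      using y chart_image_open[OF D] fun_smoothD[OF _ D] by (intro exI[of _ "\<phi> ` (U' \<inter> D)"]) auto
  qed
qed

lemma fun_smooth_const: "fun_smooth A U (\<lambda>y. c)"
  by (intro fun_smoothI) (simp add: comp_def Cinf_on_const)

lemma fun_smooth_add:
  "open U \<Longrightarrow> fun_smooth A U f \<Longrightarrow> fun_smooth A U h \<Longrightarrow> fun_smooth A U (\<lambda>y. f y + h y)"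
  by (intro fun_smoothI) (use Cinf_on_add[OF chart_image_open fun_smoothD fun_smoothD] in \<open>simp add: comp_def\<close>)

lemma fun_smooth_mult:
  "open U \<Longrightarrow> fun_smooth A U f \<Longrightarrow> fun_smooth A U h \<Longrightarrow> fun_smooth A U (\<lambda>y. f y * h y)"
  by (intro fun_smoothI)
    (use Cinf_on_bounded_bilinear[OF bounded_bilinear_mult chart_image_open fun_smoothD fun_smoothD] in
      \<open>simp add: comp_def\<close>)

lemma fun_smooth_sum:
  assumes "open U" "\<And>i. i \<in> I \<Longrightarrow> fun_smooth A U (f i)"
  shows "fun_smooth A U (\<lambda>y. \<Sum>i\<in>I. f i y)"
  using assms(2)
  by (induction I rule: infinite_finite_induct) (auto intro: fun_smooth_const fun_smooth_add assms(1))

lemma fun_smooth_differentiable: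
  assumes "(D, \<phi>) \<in> A" "x \<in> D" "x \<in> U" "fun_smooth A U f"
  shows "(f \<circ> inv_into D \<phi> has_derivative frechet_derivative (f \<circ> inv_into D \<phi>) (at (\<phi> x))) (at (\<phi> x))"
  using fun_smoothD[OF assms(4,1)] assms(2,3) by (intro Cinf_on_has_derivative) auto

lemma chart_coord_smooth:
  assumes D: "(D, \<phi>) \<in> A"
  shows "fun_smooth A D (\<lambda>y. \<phi> y \<bullet> b)"
proof (rule fun_smooth_chartI[OF D chart_open[OF D] subset_refl])
  have o: "open (\<phi> ` D)" by (rule chart_image_open'[OF D])
  have "Cinf_on (\<phi> ` D) (\<lambda>z. z \<bullet> b)"
    using Cinf_on_bounded_linear[OF o bounded_linear_inner_left Cinf_on_id[OF o]] .
  moreover have "z \<bullet> b = ((\<lambda>y. \<phi> y \<bullet> b) \<circ> inv_into D \<phi>) z" if "z \<in> \<phi> ` D" for z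
    using that D by auto
  ultimately show "Cinf_on (\<phi> ` D) ((\<lambda>y. \<phi> y \<bullet> b) \<circ> inv_into D \<phi>)"
    by (rule Cinf_on_transform[OF o])
qed

lemma fun_smooth_continuous_on:
  assumes "open U" "fun_smooth A U f"
  shows "continuous_on U f"
proof (rule continuous_at_imp_continuous_on, rule ballI)
  fix x assume x: "x \<in> U"
  obtain D \<phi> where D: "(D, \<phi>) \<in> A" "x \<in> D" using chart_at by metis
  have "isCont (f \<circ> inv_into D \<phi>) (\<phi> x)"
    using fun_smooth_differentiable[OF D x assms(2)] has_derivative_continuous by blast
  moreover have "isCont \<phi> x"
    using chart_continuous[OF D(1)] chart_open[OF D(1)] D(2) continuous_on_eq_continuous_at by blast
  ultimately have "isCont (\<lambda>y. (f \<circ> inv_into D \<phi>) (\<phi> y)) x"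
    using isCont_o2 by blast
  then show "isCont f x"
    unfolding isCont_def
    by (rule Lim_transform_within_open[OF _ chart_open[OF D(1)] D(2), THEN tendsto_eq_rhs]) (use D in auto)
qed

text \<open>The chain rule for the transition map; the two representations of \<open>F\<close> are
  related only on the overlap, which is open. \<open>F\<close> may be vector valued, so the rule
  covers real functions as well as coordinate maps.\<close>

lemma frechet_derivative_chart_change:
  assumes D: "(D, \<phi>) \<in> A" and E: "(E, \<psi>) \<in> A" and x: "x \<in> D" "x \<in> E"
    and F: "(F \<circ> inv_into D \<phi>) differentiable (at (\<phi> x))"
  shows "frechet_derivative (F \<circ> inv_into E \<psi>) (at (\<psi> x)) u =
    frechet_derivative (F \<circ> inv_into D \<phi>) (at (\<phi> x)) (frechet_derivative (\<phi> \<circ> inv_into E \<psi>) (at (\<psi> x)) u)"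
proof -
  let ?t = "\<phi> \<circ> inv_into E \<psi>"
  have t: "(?t has_derivative frechet_derivative ?t (at (\<psi> x))) (at (\<psi> x))"
    using transition_smooth[OF E D] x by (intro Cinf_on_has_derivative) auto
  have F': "(F \<circ> inv_into D \<phi> has_derivative frechet_derivative (F \<circ> inv_into D \<phi>) (at (\<phi> x))) (at (?t (\<psi> x)))"
    using F E x by (simp add: frechet_derivative_works)
  have "((\<lambda>z. (F \<circ> inv_into D \<phi>) (?t z)) has_derivative
      (\<lambda>u. frechet_derivative (F \<circ> inv_into D \<phi>) (at (\<phi> x)) (frechet_derivative ?t (at (\<psi> x)) u))) (at (\<psi> x))"
    using has_derivative_compose[OF t F'] .
  then have "(F \<circ> inv_into E \<psi> has_derivative
      (\<lambda>u. frechet_derivative (F \<circ> inv_into D \<phi>) (at (\<phi> x)) (frechet_derivative ?t (at (\<psi> x)) u))) (at (\<psi> x))"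
    by (rule has_derivative_transform_within_open[of _ _ _ _ "\<psi> ` (D \<inter> E)"])
      (use chart_image_open[OF E chart_open[OF D]] x D E in auto)
  then show ?thesis using frechet_derivative_at by metis
qed

section \<open>Directional derivatives as local derivations on smooth functions\<close>

lemma dir_cong:
  assumes "open U" "x \<in> U" "fun_smooth A U f" "\<And>y. y \<in> U \<Longrightarrow> f y = h y"
  shows "dir A x v f = dir A x v h"
proof -
  obtain D \<phi> where D: "chart_at A x = (D, \<phi>)" "(D, \<phi>) \<in> A" "x \<in> D" using chart_at .
  have "frechet_derivative (f \<circ> inv_into D \<phi>) (at (\<phi> x)) = frechet_derivative (h \<circ> inv_into D \<phi>) (at (\<phi> x))"
    by (rule frechet_derivative_transform_within_open[of _ _ "\<phi> ` (U \<inter> D)"])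
      (use chart_image_open[OF D(2) assms(1)] assms D fun_smooth_differentiable[OF D(2,3) assms(2,3)] in
        \<open>auto simp: differentiable_def\<close>)
  then show ?thesis by (simp add: dir_def D)
qed

lemma dir_linear:
  assumes "x \<in> U" "fun_smooth A U f"
  shows "linear (\<lambda>v. dir A x v f)"
proof -
  obtain D \<phi> where D: "chart_at A x = (D, \<phi>)" "(D, \<phi>) \<in> A" "x \<in> D" using chart_at .
  show ?thesis
    using has_derivative_linear[OF fun_smooth_differentiable[OF D(2,3) assms]] by (simp add: dir_def D)
qed

lemma dir_const [simp]: "dir A x v (\<lambda>y. c) = 0"
proof -
  obtain D \<phi> where D: "chart_at A x = (D, \<phi>)" using chart_at .
  show ?thesis by (simp add: dir_def D comp_def)
qed

lemma dir_add:
  assumes "x \<in> U" "fun_smooth A U f" "fun_smooth A U h"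
  shows "dir A x v (\<lambda>y. f y + h y) = dir A x v f + dir A x v h"
proof -
  obtain D \<phi> where D: "chart_at A x = (D, \<phi>)" "(D, \<phi>) \<in> A" "x \<in> D" using chart_at .
  show ?thesis
    using frechet_derivative_at[OF has_derivative_add[OF fun_smooth_differentiable[OF D(2,3) assms(1,2)]
        fun_smooth_differentiable[OF D(2,3) assms(1,3)]], symmetric]
    by (simp add: dir_def D comp_def)
qed

lemma dir_mult:
  assumes "x \<in> U" "fun_smooth A U f" "fun_smooth A U h"
  shows "dir A x v (\<lambda>y. f y * h y) = dir A x v f * h x + f x * dir A x v h"
proof -
  obtain D \<phi> where D: "chart_at A x = (D, \<phi>)" "(D, \<phi>) \<in> A" "x \<in> D" using chart_at .
  show ?thesis
    using frechet_derivative_at[OF has_derivative_mult[OF fun_smooth_differentiable[OF D(2,3) assms(1,2)]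
        fun_smooth_differentiable[OF D(2,3) assms(1,3)]], symmetric] D(3)
    by (simp add: dir_def D comp_def)
qed

lemma dir_sum:
  assumes "open U" "x \<in> U" "\<And>i. i \<in> I \<Longrightarrow> fun_smooth A U (f i)"
  shows "dir A x v (\<lambda>y. \<Sum>i\<in>I. f i y) = (\<Sum>i\<in>I. dir A x v (f i))"
  using assms(3)
proof (induction I rule: infinite_finite_induct)
  case (insert i I)
  then have "dir A x v (\<lambda>y. f i y + (\<Sum>i\<in>I. f i y)) = dir A x v (f i) + dir A x v (\<lambda>y. \<Sum>i\<in>I. f i y)"
    using fun_smooth_sum[OF assms(1), of I f] by (intro dir_add[OF assms(2)]) auto
  then show ?case using insert by simp
qed auto

text \<open>The transition derivative built into \<open>coord_field\<close> cancels the change to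
  the preferred chart, leaving a partial derivative in \<open>(D, \<phi>)\<close>.\<close>

lemma dir_coord_field:
  assumes D: "(D, \<phi>) \<in> A" and y: "y \<in> D" "y \<in> U" and f: "fun_smooth A U f"
  shows "dir A y (coord_field A D \<phi> b y) f = frechet_derivative (f \<circ> inv_into D \<phi>) (at (\<phi> y)) b"
proof -
  obtain E \<psi> where E: "chart_at A y = (E, \<psi>)" "(E, \<psi>) \<in> A" "y \<in> E" using chart_at .
  show ?thesis
    using frechet_derivative_chart_change[OF E(2) D E(3) y(1)
        differentiableI[OF fun_smooth_differentiable[OF E(2,3) y(2) f]], of b]
    by (simp add: dir_def coord_field_def E)
qed

text \<open>By \<open>dir_coord_field\<close> the action on \<open>f\<close> is a partial derivative
  in one fixed chart, from which the possibly discontinuous choice of \<open>chart_at\<close> has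
  disappeared.\<close>

lemma coord_field_smooth:
  assumes D: "(D, \<phi>) \<in> A"
  shows "vf_smooth A D (coord_field A D \<phi> b)"
  unfolding vf_smooth_def
proof (intro allI impI)
  fix U f assume U: "open U" "U \<subseteq> D" and f: "fun_smooth A U f"
  have o: "open (\<phi> ` U)" using chart_image_open[OF D U(1)] U(2) by (simp add: Int_absorb2)
  have "Cinf_on (\<phi> ` U) (\<lambda>z. frechet_derivative (f \<circ> inv_into D \<phi>) (at z) b)"
    using Cinf_on_frechet_derivative[OF fun_smoothD[OF f D]] U(2) by (simp add: Int_absorb2)
  moreover have "frechet_derivative (f \<circ> inv_into D \<phi>) (at z) b =
      ((\<lambda>y. dir A y (coord_field A D \<phi> b y) f) \<circ> inv_into D \<phi>) z" if "z \<in> \<phi> ` U" for z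
    using that U(2) D dir_coord_field[OF D _ _ f] by auto
  ultimately have "Cinf_on (\<phi> ` U) ((\<lambda>y. dir A y (coord_field A D \<phi> b y) f) \<circ> inv_into D \<phi>)"
    by (rule Cinf_on_transform[OF o])
  then show "fun_smooth A U (\<lambda>y. dir A y (coord_field A D \<phi> b y) f)"
    by (rule fun_smooth_chartI[OF D U])
qed

lemma has_derivative_chart_id:
  assumes "(D, \<phi>) \<in> A" "x \<in> D"
  shows "(\<phi> \<circ> inv_into D \<phi> has_derivative (\<lambda>u. u)) (at (\<phi> x))"
  by (rule has_derivative_transform_within_open[OF has_derivative_ident chart_image_open'[OF assms(1)]])
    (use assms in auto)

text \<open>The transition map is the identity near the base point. Hence every tangent vector at
  \<open>x\<close> is the value of a smooth field.\<close>

lemma coord_field_chart_at: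
  assumes "chart_at A x = (D, \<phi>)"
  shows "coord_field A D \<phi> b x = b"
proof -
  have "(D, \<phi>) \<in> A" "x \<in> D" using chart_at[of x] assms by auto
  then show ?thesis
    using frechet_derivative_at[OF has_derivative_chart_id, of D \<phi> x, symmetric]
    by (simp add: coord_field_def assms comp_def)
qed

text \<open>The coefficients are the derivatives of the coordinate functions along \<open>u\<close>;
  for a smooth field in place of \<open>u\<close> they are smooth functions of the point. The
  identity holds because the two transition maps between the charts are inverse to each
  other.\<close>

lemma coord_field_expansion:
  assumes D: "(D, \<phi>) \<in> A" and y: "y \<in> D"
  shows "u = (\<Sum>b\<in>Basis. dir A y u (\<lambda>z. \<phi> z \<bullet> b) *\<^sub>R coord_field A D \<phi> b y)"
proof -
  obtain E \<psi> where E: "chart_at A y = (E, \<psi>)" "(E, \<psi>) \<in> A" "y \<in> E" using chart_at .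
  define L where "L = frechet_derivative (\<phi> \<circ> inv_into E \<psi>) (at (\<psi> y))"
  define M where "M = frechet_derivative (\<psi> \<circ> inv_into D \<phi>) (at (\<phi> y))"
  have L: "(\<phi> \<circ> inv_into E \<psi> has_derivative L) (at (\<psi> y))"
    unfolding L_def using transition_smooth[OF E(2) D] y E by (intro Cinf_on_has_derivative) auto
  have M: "(\<psi> \<circ> inv_into D \<phi> has_derivative M) (at (\<phi> y))"
    unfolding M_def using transition_smooth[OF D E(2)] y E by (intro Cinf_on_has_derivative) auto
  have "dir A y u (\<lambda>z. \<phi> z \<bullet> b) = L u \<bullet> b" for b
    using frechet_derivative_at[OF has_derivative_inner_left[OF L, of b], symmetric]
    by (simp add: dir_def E comp_def)
  moreover have "coord_field A D \<phi> b y = M b" for b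
    by (simp add: coord_field_def E M_def)
  moreover have "(\<Sum>b\<in>Basis. (L u \<bullet> b) *\<^sub>R M b) = M (\<Sum>b\<in>Basis. (L u \<bullet> b) *\<^sub>R b)"
    using has_derivative_linear[OF M] by (simp add: linear_sum linear_scale)
  \<comment> \<open>The chart change rule, applied to the coordinate map \<open>\<psi>\<close>
    itself, whose representation in its own chart is the identity.\<close>
  moreover have "M (L u) = u"
    using frechet_derivative_chart_change[OF D E(2) y E(3) differentiableI[OF M], of u]
      frechet_derivative_at[OF has_derivative_chart_id[OF E(2,3)], symmetric]
    by (simp add: L_def M_def)
  ultimately show ?thesis by (simp add: euclidean_representation)
qed

section \<open>Smooth vector fields as a module over the smooth functions\<close>

lemma vf_smoothD:
  "vf_smooth A U V \<Longrightarrow> open U' \<Longrightarrow> U' \<subseteq> U \<Longrightarrow> fun_smooth A U' f \<Longrightarrow>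
    fun_smooth A U' (\<lambda>y. dir A y (V y) f)"
  unfolding vf_smooth_def by blast

lemma vf_smooth_subset: "vf_smooth A U V \<Longrightarrow> U' \<subseteq> U \<Longrightarrow> vf_smooth A U' V"
  unfolding vf_smooth_def by (meson subset_trans)

lemma vf_smooth_add:
  assumes "vf_smooth A U V" "vf_smooth A U W"
  shows "vf_smooth A U (\<lambda>y. V y + W y)"
  unfolding vf_smooth_def
proof (intro allI impI)
  fix U' f assume U': "open U'" "U' \<subseteq> U" "fun_smooth A U' f"
  show "fun_smooth A U' (\<lambda>y. dir A y (V y + W y) f)"
    by (rule fun_smooth_cong[OF U'(1) _ fun_smooth_add[OF U'(1) vf_smoothD[OF assms(1) U'] vf_smoothD[OF assms(2) U']]])
      (simp add: linear_add[OF dir_linear[OF _ U'(3)]])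
qed

lemma vf_smooth_scale:
  assumes "open U" "fun_smooth A U a" "vf_smooth A U V"
  shows "vf_smooth A U (\<lambda>y. a y *\<^sub>R V y)"
  unfolding vf_smooth_def
proof (intro allI impI)
  fix U' f assume U': "open U'" "U' \<subseteq> U" "fun_smooth A U' f"
  show "fun_smooth A U' (\<lambda>y. dir A y (a y *\<^sub>R V y) f)"
    by (rule fun_smooth_cong[OF U'(1) _ fun_smooth_mult[OF U'(1) fun_smooth_subset[OF assms(2) U'(2)] vf_smoothD[OF assms(3) U']]])
      (simp add: linear_scale[OF dir_linear[OF _ U'(3)]])
qed

lemma vf_smooth_zero: "vf_smooth A U (\<lambda>y. 0)"
  unfolding vf_smooth_def
proof (intro allI impI)
  fix U' f assume U': "open U'" "U' \<subseteq> U" "fun_smooth A U' f"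
  show "fun_smooth A U' (\<lambda>y. dir A y 0 f)"
    by (rule fun_smooth_cong[OF U'(1) _ fun_smooth_const[of _ 0]]) (simp add: linear_0[OF dir_linear[OF _ U'(3)]])
qed

lemma vf_smooth_sum:
  assumes "\<And>i. i \<in> I \<Longrightarrow> vf_smooth A U (V i)"
  shows "vf_smooth A U (\<lambda>y. \<Sum>i\<in>I. V i y)"
  using assms
  by (induction I rule: infinite_finite_induct) (auto intro: vf_smooth_zero vf_smooth_add)

end

section \<open>Boundaries of domains\<close>

lemma has_derivative_line:
  assumes "(F has_derivative F') (at p)"
  shows "((\<lambda>t. F (p + t *\<^sub>R v)) has_real_derivative F' v) (at 0)"
proof -
  have "((\<lambda>t. p + t *\<^sub>R v) has_derivative (\<lambda>t. t *\<^sub>R v)) (at 0)"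
    by (auto intro!: derivative_eq_intros)
  then have "((\<lambda>t. F (p + t *\<^sub>R v)) has_derivative (\<lambda>t. F' (t *\<^sub>R v))) (at 0)"
    using has_derivative_compose[of "\<lambda>t. p + t *\<^sub>R v" "\<lambda>t. t *\<^sub>R v" 0 UNIV F F'] assms by simp
  then show ?thesis
    using linear_scale[OF has_derivative_linear[OF assms]]
    by (simp add: has_field_derivative_def mult_commute_abs)
qed

text \<open>Along the ray from \<open>p\<close> in direction \<open>v\<close> the function
  \<open>R1\<close> becomes positive at once. A negative derivative would make \<open>R2\<close>
  negative there, against the common sign.\<close>

lemma derivative_nonneg_of_same_sign:
  fixes R1 R2 :: "'e::real_normed_vector \<Rightarrow> real"
  assumes "open O'" "p \<in> O'" and sign: "\<And>z. z \<in> O' \<Longrightarrow> R1 z < 0 \<longleftrightarrow> R2 z < 0"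
    and R1: "(R1 has_derivative R1') (at p)" "R1 p = 0"
    and R2: "(R2 has_derivative R2') (at p)" "R2 p = 0"
    and v: "R1' v > 0"
  shows "R2' v \<ge> 0"
proof (rule ccontr)
  assume "\<not> R2' v \<ge> 0"
  then obtain d2 where d2: "d2 > 0" "\<And>h. 0 < h \<Longrightarrow> h < d2 \<Longrightarrow> R2 (p + h *\<^sub>R v) < 0"
    using DERIV_neg_dec_right[OF has_derivative_line[OF R2(1)], of v] R2(2) by auto
  obtain d1 where d1: "d1 > 0" "\<And>h. 0 < h \<Longrightarrow> h < d1 \<Longrightarrow> R1 (p + h *\<^sub>R v) > 0"
    using DERIV_pos_inc_right[OF has_derivative_line[OF R1(1)] v] R1(2) by auto
  obtain d3 where d3: "d3 > 0" "ball p d3 \<subseteq> O'"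
    using assms(1,2) openE by blast
  have "((\<lambda>h. p + h *\<^sub>R v) \<longlongrightarrow> p + 0 *\<^sub>R v) (at_right 0)"
    by (intro tendsto_intros)
  then have "\<forall>\<^sub>F h in at_right 0. p + h *\<^sub>R v \<in> O'"
    using assms(1,2) topological_tendstoD by fastforce
  moreover have "\<forall>\<^sub>F h in at_right 0. 0 < h \<and> h < min d1 d2"
    using d1(1) d2(1) by (intro eventually_at_rightI[of 0 "min d1 d2"]) auto
  ultimately obtain h where "p + h *\<^sub>R v \<in> O'" "0 < h" "h < d1" "h < d2"
    using eventually_happens[OF eventually_conj] trivial_limit_at_right_real
    by (metis (mono_tags, lifting) min_less_iff_conj)
  then show False using sign d1(2)[of h] d2(2)[of h] by force
qed

text \<open>The tangent direction \<open>v\<close> is approximated by the points \<open>p + tv + stw\<close>, \<open>\<bar>s\<bar> \<le> \<epsilon>\<close>: the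
  segment between the parameters \<open>s = \<plusminus>\<epsilon>\<close> crosses the frontier of \<open>Q\<close>, since \<open>R\<close>
  changes its sign there. This replaces the implicit function theorem.\<close>

lemma derivative_zero_on_frontier:
  fixes R F :: "'e::real_normed_vector \<Rightarrow> real"
  assumes O': "open O'" "p \<in> O'" "\<And>z. z \<in> O' \<Longrightarrow> z \<in> Q \<longleftrightarrow> R z < 0"
    and R: "(R has_derivative R') (at p)" "R p = 0" and w: "R' w > 0" and v: "R' v = 0"
    and F: "(F has_derivative F') (at p)" "F p = 0" "\<And>z. z \<in> O' \<Longrightarrow> z \<in> frontier Q \<Longrightarrow> F z = 0"
  shows "F' v = 0"
proof -
  define C where "C = norm v + norm w"
  have linR: "linear R'" and linF: "linear F'"
    using R F has_derivative_linear by blast+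
  have "w \<noteq> 0" using w linear_0[OF linR] by auto
  then have C: "C > 0" unfolding C_def by (simp add: add_nonneg_pos)
  \<comment> \<open>The two terms of the bound are the linearization error of \<open>F\<close> and
    the contribution of the transverse shift by \<open>s\<close>. Both are linear in
    \<open>\<epsilon>\<close>, so the limit at 0 gives the claim; \<open>\<epsilon> \<le> 1\<close>
    keeps the test points within distance \<open>t * C\<close> of \<open>p\<close>.\<close>
  have bound: "\<bar>F' v\<bar> \<le> \<epsilon> * (C + \<bar>F' w\<bar>)" if \<epsilon>: "0 < \<epsilon>" "\<epsilon> \<le> 1" for \<epsilon>
  proof -
    \<comment> \<open>Chosen so that the error of \<open>R\<close> at distance \<open>t * C\<close>
      is half of \<open>\<epsilon> * t * R' w\<close>, the size of its linear part at the two ends;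
      the signs there are then those of \<open>s\<close>.\<close>
    define e1 where "e1 = \<epsilon> * R' w / (2 * C)"
    have e1: "e1 > 0" using w \<epsilon> C by (simp add: e1_def)
    obtain d1 where d1: "d1 > 0" "\<And>y. norm (y - p) < d1 \<Longrightarrow> norm (R y - R p - R' (y - p)) \<le> e1 * norm (y - p)"
      using R(1) e1 unfolding has_derivative_at_alt by blast
    obtain d2 where d2: "d2 > 0" "\<And>y. norm (y - p) < d2 \<Longrightarrow> norm (F y - F p - F' (y - p)) \<le> \<epsilon> * norm (y - p)"
      using F(1) \<epsilon>(1) unfolding has_derivative_at_alt by blast
    obtain d3 where d3: "d3 > 0" "ball p d3 \<subseteq> O'"
      using O' openE by blast
    define t where "t = min d1 (min d2 d3) / (2 * C)"
    have t: "t > 0" using d1 d2 d3 C by (simp add: t_def)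
    have "t * C = min d1 (min d2 d3) / 2" using C by (simp add: t_def)
    then have tC: "t * C < d1" "t * C < d2" "t * C < d3" using d1(1) d2(1) d3(1) by linarith+
    define q where "q s = p + t *\<^sub>R v + (s * t) *\<^sub>R w" for s
    have q: "norm (q s - p) \<le> t * C" if "\<bar>s\<bar> \<le> \<epsilon>" for s
    proof -
      have "norm (q s - p) \<le> t * norm v + \<bar>s\<bar> * t * norm w"
        using norm_triangle_ineq[of "t *\<^sub>R v" "(s * t) *\<^sub>R w"] t by (simp add: q_def abs_mult)
      also have "\<dots> \<le> t * norm v + 1 * t * norm w"
        using that \<epsilon> t by (intro add_left_mono mult_right_mono) auto
      finally show ?thesis by (simp add: C_def algebra_simps)
    qed
    have lin: "L (q s - p) = t * L v + s * t * L w" if "linear L" for L :: "'e \<Rightarrow> real" and s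
      using that by (simp add: q_def linear_add linear_scale add.assoc)
    have qO: "q s \<in> O'" if "\<bar>s\<bar> \<le> \<epsilon>" for s
      using q[OF that] tC(3) d3(2) by (auto simp: dist_norm norm_minus_commute subset_iff)
    have Rq: "\<bar>R (q s) - s * t * R' w\<bar> \<le> \<epsilon> * t * R' w / 2" if "\<bar>s\<bar> \<le> \<epsilon>" for s
    proof -
      have "\<bar>R (q s) - s * t * R' w\<bar> \<le> e1 * norm (q s - p)"
        using d1(2)[of "q s"] q[OF that] tC(1) R(2) lin[OF linR] v by simp
      also have "\<dots> \<le> e1 * (t * C)" using q[OF that] e1 by simp
      also have "\<dots> = \<epsilon> * t * R' w / 2" using C by (simp add: e1_def)
      finally show ?thesis .
    qed
    have pos: "\<epsilon> * t * R' w > 0" using \<epsilon> t w by simp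
    have "R (q \<epsilon>) > 0" "R (q (- \<epsilon>)) < 0"
      using abs_le_D2[OF Rq[of \<epsilon>]] abs_le_D1[OF Rq[of "- \<epsilon>"]] pos \<epsilon> by simp_all
    then have "q \<epsilon> \<notin> Q" "q (- \<epsilon>) \<in> Q" using O'(3) qO[of \<epsilon>] qO[of "- \<epsilon>"] \<epsilon> by auto
    moreover have "\<epsilon> \<in> {- \<epsilon>..\<epsilon>}" "- \<epsilon> \<in> {- \<epsilon>..\<epsilon>}" using \<epsilon> by auto
    moreover have "connected (q ` {- \<epsilon>..\<epsilon>})"
      unfolding q_def by (intro connected_continuous_image continuous_intros connected_Icc)
    ultimately have "q ` {- \<epsilon>..\<epsilon>} \<inter> frontier Q \<noteq> {}"
      by (intro connected_Int_frontier) blast+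
    then obtain s where "s \<in> {- \<epsilon>..\<epsilon>}" "q s \<in> frontier Q" by blast
    then have s: "\<bar>s\<bar> \<le> \<epsilon>" "q s \<in> frontier Q" by auto
    \<comment> \<open>\<open>F\<close> vanishes at \<open>p\<close> and at the crossing point
      \<open>q s\<close>, so the differential applied to \<open>q s - p\<close> is nothing but the
      linearization error.\<close>
    have "\<bar>t * F' v + s * t * F' w\<bar> \<le> \<epsilon> * norm (q s - p)"
      using d2(2)[of "q s"] q[OF s(1)] tC(2) F(2) F(3)[OF qO[OF s(1)] s(2)] lin[OF linF, of s] by simp
    also have "\<dots> \<le> \<epsilon> * (t * C)" using q[OF s(1)] \<epsilon> by simp
    also have "t * F' v + s * t * F' w = t * (F' v + s * F' w)" by (simp add: algebra_simps)
    finally have "t * \<bar>F' v + s * F' w\<bar> \<le> t * (\<epsilon> * C)"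
      using t by (simp add: abs_mult mult.left_commute)
    then have "\<bar>F' v + s * F' w\<bar> \<le> \<epsilon> * C" using t by simp
    moreover have "\<bar>s * F' w\<bar> \<le> \<epsilon> * \<bar>F' w\<bar>" using s(1) by (simp add: abs_mult mult_right_mono)
    ultimately show ?thesis by (simp add: distrib_left abs_le_iff)
  qed
  have "((\<lambda>\<epsilon>. \<epsilon> * (C + \<bar>F' w\<bar>)) \<longlongrightarrow> 0 * (C + \<bar>F' w\<bar>)) (at_right 0)"
    by (intro tendsto_intros)
  moreover have "\<forall>\<^sub>F \<epsilon> in at_right 0. \<bar>F' v\<bar> \<le> \<epsilon> * (C + \<bar>F' w\<bar>)"
    using bound by (intro eventually_at_rightI[of 0 1]) auto
  ultimately have "\<bar>F' v\<bar> \<le> 0 * (C + \<bar>F' w\<bar>)"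
    by (intro tendsto_lowerbound) auto
  then show ?thesis by simp
qed

section \<open>Local defining functions and the tangent space of the boundary\<close>

context smooth_manifold
begin

text \<open>A negative value would put the point into the open set \<open>\<Omega>\<close>, which
  misses its frontier. A positive value persists nearby by continuity, and \<open>x\<close> would
  not be in the closure.\<close>

lemma local_defining_function_frontier_zero:
  assumes "open \<Omega>" "local_defining_function A \<Omega> U r" "x \<in> frontier \<Omega>" "x \<in> U"
  shows "r x = 0"
proof (rule ccontr)
  assume "r x \<noteq> 0"
  have "x \<notin> \<Omega>" using assms(1,3) frontier_def interior_open by blast
  then have pos: "r x > 0"
    using assms(2,4) \<open>r x \<noteq> 0\<close> unfolding local_defining_function_def by (auto simp: set_eq_iff)
  have U: "open U" "continuous_on U r" "\<Omega> \<inter> U = {y\<in>U. r y < 0}"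
    using assms(2) fun_smooth_continuous_on unfolding local_defining_function_def by blast+
  have "open (U \<inter> r -` {0<..})"
    using continuous_open_preimage U open_greaterThan by blast
  moreover have "x \<in> U \<inter> r -` {0<..}" using assms(4) pos by simp
  moreover have "(U \<inter> r -` {0<..}) \<inter> \<Omega> = {}" using U(3) by (force simp: set_eq_iff)
  ultimately have "x \<notin> closure \<Omega>" using open_Int_closure_eq_empty[of _ \<Omega>] by blast
  then show False using assms(3) by (simp add: frontier_def)
qed

text \<open>This makes the outward side independent of the local defining function. It fixes the
  sign of the normal and excludes cancellation when defining functions are glued.\<close>

lemma dir_nonneg_of_local_defining_functions:
  assumes "open \<Omega>" "x \<in> frontier \<Omega>"
    and r: "local_defining_function A \<Omega> U r" "x \<in> U"
    and s: "local_defining_function A \<Omega> V s" "x \<in> V"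
    and v: "dir A x v r > 0"
  shows "dir A x v s \<ge> 0"
proof -
  obtain D \<phi> where D: "chart_at A x = (D, \<phi>)" "(D, \<phi>) \<in> A" "x \<in> D" using chart_at .
  have U: "open U" "fun_smooth A U r" "\<Omega> \<inter> U = {y\<in>U. r y < 0}"
    and V: "open V" "fun_smooth A V s" "\<Omega> \<inter> V = {y\<in>V. s y < 0}"
    using r(1) s(1) unfolding local_defining_function_def by blast+
  have o: "open (\<phi> ` (U \<inter> V \<inter> D))" using chart_image_open[OF D(2) open_Int[OF U(1) V(1)]] .
  have p: "\<phi> x \<in> \<phi> ` (U \<inter> V \<inter> D)" using D r s by blast
  have sign: "(r \<circ> inv_into D \<phi>) z < 0 \<longleftrightarrow> (s \<circ> inv_into D \<phi>) z < 0"
    if "z \<in> \<phi> ` (U \<inter> V \<inter> D)" for z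
  proof -
    obtain y where y: "y \<in> U" "y \<in> V" "y \<in> D" "z = \<phi> y" using \<open>z \<in> _\<close> by blast
    then have "y \<in> \<Omega> \<longleftrightarrow> r y < 0" "y \<in> \<Omega> \<longleftrightarrow> s y < 0" using U(3) V(3) by blast+
    then show ?thesis using y D(2) by simp
  qed
  have "frechet_derivative (r \<circ> inv_into D \<phi>) (at (\<phi> x)) v > 0"
    using v by (simp add: dir_def D)
  then have "frechet_derivative (s \<circ> inv_into D \<phi>) (at (\<phi> x)) v \<ge> 0"
    using derivative_nonneg_of_same_sign[OF o p sign fun_smooth_differentiable[OF D(2,3) r(2) U(2)] _
        fun_smooth_differentiable[OF D(2,3) s(2) V(2)]]
      local_defining_function_frontier_zero[OF assms(1) r(1) assms(2) r(2)]
      local_defining_function_frontier_zero[OF assms(1) s(1) assms(2) s(2)] D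
    by simp
  then show ?thesis by (simp add: dir_def D)
qed

lemma local_defining_function_dir_pos:
  assumes "local_defining_function A \<Omega> U r" "x \<in> frontier \<Omega>" "x \<in> U"
  obtains w where "dir A x w r > 0"
proof -
  obtain w where "dir A x w r \<noteq> 0"
    using assms unfolding local_defining_function_def by blast
  moreover have "dir A x (- w) r = - dir A x w r"
    using linear_neg[OF dir_linear[OF assms(3)]] assms(1) unfolding local_defining_function_def by blast
  ultimately show ?thesis using that[of w] that[of "- w"] by linarith
qed

text \<open>The crossing argument produces frontier points of the chart image of
  \<open>\<Omega>\<close>; this carries them back to the manifold. A point off the closure has a
  neighbourhood whose chart image is open and disjoint from that of \<open>\<Omega>\<close>.\<close>

lemma frontier_chart_image:
  assumes D: "(D, \<phi>) \<in> A" and "open \<Omega>" "y \<in> D" "\<phi> y \<in> frontier (\<phi> ` (\<Omega> \<inter> D))"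
  shows "y \<in> frontier \<Omega>"
proof -
  let ?N = "\<phi> ` (- closure \<Omega> \<inter> D)"
  have "y \<notin> \<Omega>"
    using assms chart_image_open[OF D assms(2)] by (auto simp: frontier_def interior_open)
  moreover have "y \<in> closure \<Omega>"
  proof (rule ccontr)
    assume "y \<notin> closure \<Omega>"
    then have "\<phi> y \<in> ?N" using assms(3) by blast
    moreover have "open ?N" by (intro chart_image_open[OF D]) auto
    moreover have "?N \<inter> \<phi> ` (\<Omega> \<inter> D) = {}"
      using inj_on_image_Int[OF chart_inj[OF D], of "- closure \<Omega> \<inter> D" "\<Omega> \<inter> D"] closure_subset[of \<Omega>]
      by auto
    ultimately have "\<phi> y \<notin> closure (\<phi> ` (\<Omega> \<inter> D))"
      using open_Int_closure_eq_empty[of ?N "\<phi> ` (\<Omega> \<inter> D)"] by blast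
    then show False using assms(4) by (simp add: frontier_def)
  qed
  ultimately show ?thesis using assms(2) by (simp add: frontier_def interior_open)
qed

text \<open>One inclusion tests a tangent vector on \<open>r\<close> itself, which vanishes on the
  frontier. The other is \<open>derivative_zero_on_frontier\<close> in a chart: every smooth
  function vanishing on the boundary is stationary along the kernel of the differential of
  \<open>r\<close>.\<close>

lemma tangent_to_frontier:
  assumes "open \<Omega>" and r: "local_defining_function A \<Omega> U r" and x: "x \<in> frontier \<Omega>" "x \<in> U"
  shows "tangent_to A (frontier \<Omega>) x = {v. dir A x v r = 0}"
proof (intro equalityI subsetI CollectI)
  have U: "open U" "fun_smooth A U r" "\<Omega> \<inter> U = {y\<in>U. r y < 0}"
    using r unfolding local_defining_function_def by blast+
  fix v
  show "dir A x v r = 0" if "v \<in> tangent_to A (frontier \<Omega>) x"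
    using that U x local_defining_function_frontier_zero[OF assms(1) r]
    unfolding tangent_to_def by blast
  assume "v \<in> {v. dir A x v r = 0}"
  then have v: "dir A x v r = 0" by simp
  obtain w where w: "dir A x w r > 0" using local_defining_function_dir_pos[OF r x] .
  show "v \<in> tangent_to A (frontier \<Omega>) x"
    unfolding tangent_to_def
  proof (intro CollectI allI impI)
    fix V f assume V: "open V" "x \<in> V" "fun_smooth A V f" "\<forall>y\<in>V \<inter> frontier \<Omega>. f y = 0"
    obtain D \<phi> where D: "chart_at A x = (D, \<phi>)" "(D, \<phi>) \<in> A" "x \<in> D" using chart_at .
    have o: "open (\<phi> ` (U \<inter> V \<inter> D))" using chart_image_open[OF D(2) open_Int[OF U(1) V(1)]] .
    have p: "\<phi> x \<in> \<phi> ` (U \<inter> V \<inter> D)" using D x V by blast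
    have Q: "z \<in> \<phi> ` (\<Omega> \<inter> D) \<longleftrightarrow> (r \<circ> inv_into D \<phi>) z < 0" if "z \<in> \<phi> ` (U \<inter> V \<inter> D)" for z
    proof -
      obtain y where y: "y \<in> U" "y \<in> D" "z = \<phi> y" using \<open>z \<in> _\<close> by blast
      then have "y \<in> \<Omega> \<longleftrightarrow> r y < 0" using U(3) by blast
      moreover have "z \<in> \<phi> ` (\<Omega> \<inter> D) \<longleftrightarrow> y \<in> \<Omega>"
        using inj_on_image_mem_iff[OF chart_inj[OF D(2)] y(2), of "\<Omega> \<inter> D"] y by simp
      ultimately show ?thesis using y D(2) by simp
    qed
    have z: "(f \<circ> inv_into D \<phi>) z = 0"
      if "z \<in> \<phi> ` (U \<inter> V \<inter> D)" "z \<in> frontier (\<phi> ` (\<Omega> \<inter> D))" for z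
      using that V(4) frontier_chart_image[OF D(2) assms(1)] D(2) by auto
    have "frechet_derivative (f \<circ> inv_into D \<phi>) (at (\<phi> x)) v = 0"
    proof (rule derivative_zero_on_frontier[OF o p Q fun_smooth_differentiable[OF D(2,3) x(2) U(2)] _ _ _
          fun_smooth_differentiable[OF D(2,3) V(2,3)] _ z])
      show "(r \<circ> inv_into D \<phi>) (\<phi> x) = 0" "(f \<circ> inv_into D \<phi>) (\<phi> x) = 0"
        using local_defining_function_frontier_zero[OF assms(1) r x] D V x by simp_all
      show "frechet_derivative (r \<circ> inv_into D \<phi>) (at (\<phi> x)) w > 0"
        "frechet_derivative (r \<circ> inv_into D \<phi>) (at (\<phi> x)) v = 0"
        using v w by (simp_all add: dir_def D)
    qed
    then show "dir A x v f = 0" by (simp add: dir_def D)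
  qed
qed

text \<open>A radial bump in a chart, extended by zero. Besides its positivity on \<open>V\<close>,
  the closed set \<open>K\<close> inside \<open>U\<close> is recorded: it allows products with
  functions that are smooth only on \<open>U\<close>.\<close>

lemma local_bump:
  assumes "open U" "x \<in> U"
  obtains V K \<beta> where "open V" "x \<in> V" "closed K" "K \<subseteq> U" "fun_smooth A UNIV \<beta>"
    "\<And>y. \<beta> y \<ge> 0" "\<And>y. y \<in> V \<Longrightarrow> \<beta> y > 0" "\<And>y. y \<notin> K \<Longrightarrow> \<beta> y = 0"
proof -
  obtain D \<phi> where D: "(D, \<phi>) \<in> A" "x \<in> D" using chart_at by metis
  have "open (\<phi> ` (U \<inter> D))" "\<phi> x \<in> \<phi> ` (U \<inter> D)"
    using chart_image_open D assms by blast+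
  then obtain s where s: "s > 0" "cball (\<phi> x) s \<subseteq> \<phi> ` (U \<inter> D)"
    using open_contains_cball by blast
  \<comment> \<open>The argument is the squared radius minus the squared distance from
    \<open>\<phi> x\<close>, positive exactly inside the ball; it is written with a sum and products
    to match the closure rules for smooth maps.\<close>
  define \<eta> where "\<eta> z = flat_exp 0 (s\<^sup>2 + (- 1) * ((z - \<phi> x) \<bullet> (z - \<phi> x)))" for z
  define \<beta> where "\<beta> y = (if y \<in> D then \<eta> (\<phi> y) else 0)" for y
  define K where "K = inv_into D \<phi> ` cball (\<phi> x) s"
  define V where "V = D \<inter> \<phi> -` ball (\<phi> x) s"
  have "compact K"
    unfolding K_def using s(2)
    by (intro compact_continuous_image continuous_on_subset[OF chart_inv_continuous[OF D(1)]]) auto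
  \<comment> \<open>Closed in the whole space by the Hausdorff property, not merely in
    \<open>D\<close>; hence the extension by zero is smooth at points outside
    \<open>D\<close>.\<close>
  then have K: "closed K" by (rule compact_imp_closed)
  have \<eta>_zero: "\<eta> z = 0" if "z \<notin> cball (\<phi> x) s" for z
  proof -
    have "s < norm (z - \<phi> x)" using that by (simp add: dist_norm norm_minus_commute)
    then have "s\<^sup>2 \<le> (norm (z - \<phi> x))\<^sup>2" using s(1) by (intro power_mono) auto
    then show ?thesis by (simp add: \<eta>_def flat_exp_def power2_norm_eq_inner)
  qed
  have zero: "\<beta> y = 0" if "y \<notin> K" for y
  proof (cases "y \<in> D")
    case True
    then have "\<phi> y \<notin> cball (\<phi> x) s"
      using that chart_inv[OF D(1) True] unfolding K_def by (metis imageI)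
    then show ?thesis by (simp add: \<beta>_def \<eta>_zero)
  qed (simp add: \<beta>_def)
  have \<eta>: "Cinf_on UNIV \<eta>"
  proof -
    have "Cinf_on UNIV (\<lambda>z. z + - \<phi> x)"
      by (intro Cinf_on_add Cinf_on_id Cinf_on_const) auto
    then have "Cinf_on UNIV (\<lambda>z. z - \<phi> x)" by simp
    then have "Cinf_on UNIV (\<lambda>z. s\<^sup>2 + (- 1) * ((z - \<phi> x) \<bullet> (z - \<phi> x)))"
      by (intro Cinf_on_add Cinf_on_const Cinf_on_bounded_bilinear[OF bounded_bilinear_mult]
          Cinf_on_bounded_bilinear[OF bounded_bilinear_inner]) auto
    from Cinf_on_compose[OF open_UNIV open_UNIV this Cinf_on_flat_exp] show ?thesis
      unfolding \<eta>_def by simp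
  qed
  have "fun_smooth A UNIV \<beta>"
  proof (rule fun_smooth_local)
    fix y
    show "\<exists>U'. open U' \<and> y \<in> U' \<and> fun_smooth A U' \<beta>"
    proof (cases "y \<in> D")
      case True
      have "Cinf_on (\<phi> ` D) (\<beta> \<circ> inv_into D \<phi>)"
        by (rule Cinf_on_transform[OF chart_image_open'[OF D(1)] Cinf_on_subset[OF \<eta>]])
          (use D(1) in \<open>auto simp: \<beta>_def\<close>)
      then show ?thesis
        using True chart_open[OF D(1)] fun_smooth_chartI[OF D(1)] by blast
    next
      case False
      have "K \<subseteq> D" unfolding K_def using s(2) by (force simp: inv_into_into)
      then have "y \<in> - K" using False by blast
      moreover have "open (- K)" using K by blast
      moreover have "fun_smooth A (- K) \<beta>"
        by (rule fun_smooth_cong[OF \<open>open (- K)\<close> _ fun_smooth_const[of _ 0]]) (simp add: zero)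
      ultimately show ?thesis by blast
    qed
  qed
  moreover have "open V"
    unfolding V_def using chart_open chart_continuous D(1) continuous_open_preimage by blast
  moreover have "x \<in> V" using D s(1) by (simp add: V_def)
  moreover have "K \<subseteq> U" unfolding K_def using s(2) D(1) by force
  moreover have "\<beta> y \<ge> 0" for y by (simp add: \<beta>_def \<eta>_def flat_exp_def)
  moreover have "\<beta> y > 0" if "y \<in> V" for y
  proof -
    have "norm (\<phi> y - \<phi> x) < s" using that by (simp add: V_def dist_norm norm_minus_commute)
    then have "(norm (\<phi> y - \<phi> x))\<^sup>2 < s\<^sup>2" using s(1) by (intro power_strict_mono) auto
    then show ?thesis
      using that by (simp add: V_def \<beta>_def \<eta>_def flat_exp_def power2_norm_eq_inner)
  qed
  ultimately show ?thesis using that K zero by blast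
qed

lemma fun_smooth_cutoff:
  assumes "open U" "fun_smooth A U r" "closed K" "K \<subseteq> U" "fun_smooth A UNIV \<beta>" "\<And>y. y \<notin> K \<Longrightarrow> \<beta> y = 0"
  shows "fun_smooth A UNIV (\<lambda>y. \<beta> y * r y)"
proof (rule fun_smooth_local)
  fix y
  show "\<exists>U'. open U' \<and> y \<in> U' \<and> fun_smooth A U' (\<lambda>y. \<beta> y * r y)"
  proof (cases "y \<in> K")
    case True
    then show ?thesis
      using assms fun_smooth_mult[OF assms(1) fun_smooth_subset[OF assms(5)] assms(2)] by blast
  next
    case False
    have o: "open (- K)" using assms(3) by blast
    have "fun_smooth A (- K) (\<lambda>y. \<beta> y * r y)"
      by (rule fun_smooth_cong[OF o _ fun_smooth_const[of _ 0]]) (simp add: assms(6))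
    then show ?thesis using False o by blast
  qed
qed

text \<open>Local defining functions can be glued with arbitrary nonnegative cut-off functions:
  their differentials at a boundary point are all nonnegative on a common outward direction, so
  no cancellation occurs.\<close>

lemma defining_function_exists:
  assumes "open \<Omega>" "compact (closure \<Omega>)" "smooth_boundary A \<Omega>"
  obtains U \<rho> where "closure \<Omega> \<subseteq> U" "local_defining_function A \<Omega> U \<rho>"
proof -
  define good where "good x V K U \<beta> r \<longleftrightarrow> open V \<and> x \<in> V \<and> closed K \<and> K \<subseteq> U \<and>
    local_defining_function A \<Omega> U r \<and> fun_smooth A UNIV \<beta> \<and> (\<forall>y. \<beta> y \<ge> 0) \<and> (\<forall>y\<in>V. \<beta> y > 0) \<and>
    (\<forall>y. y \<notin> K \<longrightarrow> \<beta> y = 0)" for x V K U and \<beta> r :: "'x \<Rightarrow> real"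
  have "\<exists>V K U \<beta> r. good x V K U \<beta> r" if "x \<in> closure \<Omega>" for x
  proof -
    have "\<exists>U r. x \<in> U \<and> local_defining_function A \<Omega> U r"
    proof (cases "x \<in> \<Omega>")
      case True
      \<comment> \<open>At interior points a negative constant works: the open set
        \<open>\<Omega>\<close> contains no frontier point, so the regularity condition is
        vacuous.\<close>
      have "local_defining_function A \<Omega> \<Omega> (\<lambda>y. - 1)"
        using assms(1) by (auto simp: local_defining_function_def fun_smooth_const frontier_def interior_open)
      then show ?thesis using True by blast
    next
      case False
      then have "x \<in> frontier \<Omega>" using that assms(1) by (simp add: frontier_def interior_open)
      then show ?thesis using assms(3) unfolding smooth_boundary_def by blast
    qed
    then obtain U r where U: "x \<in> U" "local_defining_function A \<Omega> U r" by blast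
    then have "open U" unfolding local_defining_function_def by blast
    then obtain V K \<beta> where "open V" "x \<in> V" "closed K" "K \<subseteq> U" "fun_smooth A UNIV \<beta>"
      "\<And>y. \<beta> y \<ge> 0" "\<And>y. y \<in> V \<Longrightarrow> \<beta> y > 0" "\<And>y. y \<notin> K \<Longrightarrow> \<beta> y = 0"
      by (rule local_bump[OF _ U(1)]) blast
    then have "good x V K U \<beta> r" using U(2) by (simp add: good_def)
    then show ?thesis by blast
  qed
  then obtain V K U \<beta> r where good: "\<And>x. x \<in> closure \<Omega> \<Longrightarrow> good x (V x) (K x) (U x) (\<beta> x) (r x)"
    by metis
  then have g: "open (V x)" "x \<in> V x" "closed (K x)" "K x \<subseteq> U x" "local_defining_function A \<Omega> (U x) (r x)"
    "fun_smooth A UNIV (\<beta> x)" "\<beta> x y \<ge> 0" "y \<in> V x \<Longrightarrow> \<beta> x y > 0" "y \<notin> K x \<Longrightarrow> \<beta> x y = 0"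
    if "x \<in> closure \<Omega>" for x y
    using that unfolding good_def by blast+
  have gU: "open (U x)" "fun_smooth A (U x) (r x)" "\<Omega> \<inter> U x = {y\<in>U x. r x y < 0}"
    if "x \<in> closure \<Omega>" for x
    using g(5)[OF that] unfolding local_defining_function_def by blast+
  obtain S where S: "S \<subseteq> closure \<Omega>" "finite S" "closure \<Omega> \<subseteq> (\<Union>x\<in>S. V x)"
    using compactE_image[OF assms(2), of "closure \<Omega>" V] g(1,2) by blast
  define \<rho> where "\<rho> y = (\<Sum>x\<in>S. \<beta> x y * r x y)" for y
  define U0 where "U0 = (\<Union>x\<in>S. V x)"
  have smooth: "fun_smooth A UNIV (\<lambda>y. \<beta> x y * r x y)" if "x \<in> S" for x
  proof -
    have x: "x \<in> closure \<Omega>" using S(1) that by blast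
    show ?thesis by (rule fun_smooth_cutoff[OF gU(1,2) g(3,4,6,9)]) (rule x | assumption)+
  qed
  then have \<rho>_smooth: "fun_smooth A UNIV \<rho>"
    unfolding \<rho>_def by (intro fun_smooth_sum) auto
  have VK: "V x \<subseteq> K x" if "x \<in> S" for x
    using g(8,9) S(1) that by (metis less_irrefl subsetD subsetI)
  have neg: "\<rho> y < 0" if y: "y \<in> \<Omega>" for y
  proof -
    have le: "\<beta> x y * r x y \<le> 0" if "x \<in> S" for x
    proof (cases "y \<in> K x")
      case True
      then have "r x y < 0" using S(1) that g(4) gU(3) y by blast
      then show ?thesis using g(7)[of x y] S(1) that by (simp add: mult_nonneg_nonpos subset_iff)
    next
      case False
      then show ?thesis using g(9)[of x y] S(1) that by (simp add: subset_iff)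
    qed
    obtain x where x: "x \<in> S" "y \<in> V x" using S(3) y closure_subset[of \<Omega>] by blast
    have "r x y < 0" using x VK S(1) g(4) gU(3) y by blast
    then have "\<beta> x y * r x y < 0" using x g(8)[of x y] S(1) by (simp add: mult_pos_neg subset_iff)
    then show ?thesis
      unfolding \<rho>_def using sum_strict_mono_ex1[OF S(2), of "\<lambda>x. \<beta> x y * r x y" "\<lambda>x. 0"] le x(1) by auto
  qed
  have nonneg: "\<rho> y \<ge> 0" if y: "y \<notin> \<Omega>" for y
    unfolding \<rho>_def
  proof (rule sum_nonneg)
    fix x assume x: "x \<in> S"
    show "\<beta> x y * r x y \<ge> 0"
    proof (cases "y \<in> K x")
      case True
      then have "\<not> r x y < 0" using S(1) x g(4) gU(3) y by blast
      then show ?thesis using g(7)[of x y] S(1) x by (simp add: subset_iff)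
    next
      case False
      then show ?thesis using g(9)[of x y] S(1) x by (simp add: subset_iff)
    qed
  qed
  have regular: "\<exists>v. dir A y v \<rho> \<noteq> 0" if y: "y \<in> frontier \<Omega>" for y
  proof -
    have "y \<in> closure \<Omega>" using y by (simp add: frontier_def)
    then obtain x1 where x1: "x1 \<in> S" "y \<in> V x1" using S(3) by blast
    then have yU: "y \<in> U x1" "x1 \<in> closure \<Omega>" using VK S(1) g(4) by blast+
    obtain v where v: "dir A y v (r x1) > 0"
      using local_defining_function_dir_pos[OF g(5)[OF yU(2)] y yU(1)] .
    \<comment> \<open>The product rule; the term with the derivative of the cut-off function drops
      out because \<open>r x\<close> vanishes on the frontier.\<close>
    have term_eq: "dir A y v (\<lambda>y. \<beta> x y * r x y) = \<beta> x y * dir A y v (r x)"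
      if "x \<in> closure \<Omega>" "y \<in> U x" for x
      using dir_mult[OF that(2) fun_smooth_subset[OF g(6)[OF that(1)]] gU(2)[OF that(1)]]
        local_defining_function_frontier_zero[OF assms(1) g(5)[OF that(1)] y that(2)] by simp
    have "dir A y v (\<lambda>y. \<beta> x y * r x y) \<ge> 0" if "x \<in> S" for x
    proof (cases "y \<in> K x")
      case True
      have x: "x \<in> closure \<Omega>" "y \<in> U x" using that S(1) True g(4) by blast+
      have "dir A y v (r x) \<ge> 0"
        using dir_nonneg_of_local_defining_functions[OF assms(1) y g(5)[OF yU(2)] yU(1) g(5)[OF x(1)] x(2) v] .
      then show ?thesis using term_eq[OF x] g(7)[OF x(1), of y] by simp
    next
      case False
      \<comment> \<open>Here \<open>y\<close> may lie outside \<open>U x\<close>, where nothing is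
        known about \<open>r x\<close>; but the product is zero on the open complement of
        \<open>K x\<close>.\<close>
      have "dir A y v (\<lambda>y. \<beta> x y * r x y) = dir A y v (\<lambda>y. 0)"
        by (rule dir_cong[of "- K x"])
          (use False fun_smooth_subset[OF smooth[OF that]] open_Compl[OF g(3)[of x]] g(9)[of x] S(1) that in auto)
      then show ?thesis by simp
    qed
    moreover have "dir A y v (\<lambda>y. \<beta> x1 y * r x1 y) > 0"
      using term_eq[OF yU(2,1)] v g(8)[OF yU(2) x1(2)] by simp
    ultimately have "(\<Sum>x\<in>S. dir A y v (\<lambda>y. \<beta> x y * r x y)) > 0"
      using sum_strict_mono_ex1[OF S(2), of "\<lambda>x. 0" "\<lambda>x. dir A y v (\<lambda>y. \<beta> x y * r x y)"] x1(1) by auto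
    moreover have "dir A y v \<rho> = (\<Sum>x\<in>S. dir A y v (\<lambda>y. \<beta> x y * r x y))"
      unfolding \<rho>_def using smooth by (intro dir_sum[of UNIV]) auto
    ultimately show ?thesis by (metis less_irrefl)
  qed
  have "open U0" unfolding U0_def using g(1) S(1) by blast
  moreover have "\<Omega> \<inter> U0 = {y\<in>U0. \<rho> y < 0}" using neg nonneg by force
  ultimately have "local_defining_function A \<Omega> U0 \<rho>"
    unfolding local_defining_function_def using fun_smooth_subset[OF \<rho>_smooth] regular by blast
  then show ?thesis using that S(3) unfolding U0_def by blast
qed

end

section \<open>Hessian and second fundamental form\<close>

text \<open>The metric at a point is in general different from the inner product
  \<open>\<bullet>\<close> of the model space, so Riesz representation and orthonormal bases are
  treated for an arbitrary positive definite symmetric form.\<close>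

locale inner_product_form =
  fixes h :: "'e::euclidean_space \<Rightarrow> 'e \<Rightarrow> real"
  assumes bilinear: "bilinear h"
    and sym: "h u v = h v u"
    and pos: "u \<noteq> 0 \<Longrightarrow> h u u > 0"
begin

lemmas form_simps = bilinear_ladd[OF bilinear] bilinear_radd[OF bilinear]
  bilinear_lmul[OF bilinear] bilinear_rmul[OF bilinear] bilinear_lzero[OF bilinear]
  bilinear_rzero[OF bilinear] bilinear_lsub[OF bilinear] bilinear_rsub[OF bilinear]

lemma linear_left: "linear (\<lambda>u. h u v)"
  and linear_right: "linear (h v)"
  using bilinear by (simp_all add: bilinear_def)

lemma eq_zero_iff: "h u u = 0 \<longleftrightarrow> u = 0"
  using pos[of u] by (cases "u = 0") (auto simp: form_simps)

lemma riesz_unique: "(\<And>v. h u v = h u' v) \<Longrightarrow> u = u'"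
  using eq_zero_iff[of "u - u'"] by (simp add: form_simps)

text \<open>The map \<open>T\<close> lists the values of \<open>h u\<close> on the standard basis.
  Definiteness makes it injective, hence surjective by finite dimension.\<close>

lemma riesz_exists:
  assumes "linear L"
  shows "\<exists>u. \<forall>v. h u v = L v"
proof -
  define T where "T u = (\<Sum>b\<in>Basis. h u b *\<^sub>R b)" for u
  have T: "T u \<bullet> b = h u b" if "b \<in> Basis" for u b
    using that by (simp add: T_def inner_sum_left_Basis)
  have "linear T"
    unfolding T_def
    by (intro linearI) (simp_all add: form_simps scaleR_add_left sum.distrib scaleR_sum_right)
  moreover have "inj T"
  proof (rule injI)
    fix u u' assume "T u = T u'"
    then have "h u b = h u' b" if "b \<in> Basis" for b using T[OF that] by metis
    then have "h u = h u'" using linear_eq_stdbasis[OF linear_right linear_right] by blast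
    then show "u = u'" by (intro riesz_unique) simp
  qed
  ultimately have "surj T" by (rule linear_injective_imp_surjective) (rule refl)
  then obtain u where "T u = (\<Sum>b\<in>Basis. L b *\<^sub>R b)" by (metis surjD)
  then have "h u b = L b" if "b \<in> Basis" for b
    using T[OF that, of u] that by (simp add: inner_sum_left_Basis)
  then have "h u = L" using linear_eq_stdbasis[OF linear_right assms] by blast
  then show ?thesis by auto
qed

definition orthonormal :: "'e set \<Rightarrow> bool" where
  "orthonormal E \<longleftrightarrow> (\<forall>e\<in>E. \<forall>e'\<in>E. h e e' = (if e = e' then 1 else 0))"

lemma orthonormal_card_le:
  assumes "finite E" "orthonormal E"
  shows "card E \<le> DIM('e)"
proof -
  have "independent E"
  proof (rule independent_if_scalars_zero[OF assms(1)])
    fix c x assume c: "(\<Sum>e\<in>E. c e *\<^sub>R e) = 0" and x: "x \<in> E"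
    have "0 = h (\<Sum>e\<in>E. c e *\<^sub>R e) x" by (simp add: c form_simps)
    also have "\<dots> = (\<Sum>e\<in>E. c e * h e x)"
      by (simp add: linear_sum[OF linear_left] form_simps)
    also have "\<dots> = (\<Sum>e\<in>E. if e = x then c e else 0)"
      using assms(2) x by (intro sum.cong) (auto simp: orthonormal_def)
    also have "\<dots> = c x" using assms(1) x by simp
    finally show "c x = 0" by simp
  qed
  then show ?thesis using independent_bound by blast
qed

text \<open>Among orthonormal subsets of \<open>W\<close> one of maximal cardinality exists since
  \<open>orthonormal_card_le\<close> bounds them. If it did not span, the normalized residual
  \<open>u\<close> of some \<open>w\<close> could be added. This gives meaning to the choice inside
  \<open>metric_trace\<close>.\<close>

lemma orthonormal_basis_exists:
  assumes W: "subspace W"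
  shows "\<exists>E. finite E \<and> span E = W \<and> (\<forall>e\<in>E. \<forall>e'\<in>E. h e e' = (if e = e' then 1 else 0))"
proof -
  let ?P = "\<lambda>E. finite E \<and> E \<subseteq> W \<and> orthonormal E"
  have "?P {}" by (simp add: orthonormal_def)
  moreover have "\<forall>E. ?P E \<longrightarrow> card E < Suc DIM('e)" using orthonormal_card_le by (auto simp: less_Suc_eq_le)
  ultimately obtain E where E: "finite E" "E \<subseteq> W" "orthonormal E" and max: "\<And>E'. ?P E' \<Longrightarrow> card E' \<le> card E"
    using ex_has_greatest_nat[of ?P "{}" card "Suc DIM('e)"] by blast
  have "w \<in> span E" if w: "w \<in> W" for w
  proof -
    define u where "u = w - (\<Sum>e\<in>E. h w e *\<^sub>R e)"
    have sumW: "(\<Sum>e\<in>E. h w e *\<^sub>R e) \<in> W"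
      using W E(2) by (intro subspace_sum) (auto intro: subspace_scale)
    have orth: "h u x = 0" if x: "x \<in> E" for x
    proof -
      have "h (\<Sum>e\<in>E. h w e *\<^sub>R e) x = (\<Sum>e\<in>E. h w e * h e x)"
        by (simp add: linear_sum[OF linear_left] form_simps)
      also have "\<dots> = (\<Sum>e\<in>E. if e = x then h w e else 0)"
        using E(3) x by (intro sum.cong) (auto simp: orthonormal_def)
      also have "\<dots> = h w x" using E(1) x by simp
      finally show ?thesis by (simp add: u_def form_simps)
    qed
    have "u = 0"
    proof (rule ccontr)
      assume "u \<noteq> 0"
      define e where "e = (1 / sqrt (h u u)) *\<^sub>R u"
      have ee: "h e e = 1" using pos[OF \<open>u \<noteq> 0\<close>] by (simp add: e_def form_simps)
      have ex: "h e x = 0" "h x e = 0" if "x \<in> E" for x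
        using orth[OF that] sym[of x u] by (simp_all add: e_def form_simps)
      have "e \<notin> E" using ex(1)[of e] ee by auto
      moreover have "e \<in> W"
        unfolding e_def u_def by (intro subspace_scale[OF W] subspace_diff[OF W] w sumW)
      moreover have "orthonormal (insert e E)"
        using E(3) ee ex \<open>e \<notin> E\<close> unfolding orthonormal_def by auto
      ultimately show False using max[of "insert e E"] E by simp
    qed
    then have "w = (\<Sum>e\<in>E. h w e *\<^sub>R e)" by (simp add: u_def)
    moreover have "(\<Sum>e\<in>E. h w e *\<^sub>R e) \<in> span E"
      by (intro span_sum span_scale span_base)
    ultimately show ?thesis by simp
  qed
  then have "span E = W" using span_minimal[OF E(2) W] by blast
  then show ?thesis using E unfolding orthonormal_def by blast
qed

text \<open>Names the basis chosen in \<open>metric_trace\<close>. It depends on \<open>h\<close>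
  and \<open>W\<close> only, so traces of different forms are sums over literally the same
  vectors.\<close>

definition trace_basis :: "'e set \<Rightarrow> 'e set" where
  "trace_basis W = (SOME E. finite E \<and> span E = W \<and> (\<forall>e\<in>E. \<forall>e'\<in>E. h e e' = (if e = e' then 1 else 0)))"

lemma trace_basis_subset:
  assumes "subspace W"
  shows "trace_basis W \<subseteq> W"
proof -
  have "span (trace_basis W) = W"
    using someI_ex[OF orthonormal_basis_exists[OF assms]] unfolding trace_basis_def by blast
  then show ?thesis using span_superset[of "trace_basis W"] by simp
qed

lemma metric_trace_eq: "metric_trace h W b = (\<Sum>e\<in>trace_basis W. b e e)"
  by (simp add: metric_trace_def trace_basis_def)

text \<open>Serves twice: with a real factor \<open>c\<close> for the Hessian, and with the normal
  vector as \<open>c\<close> for the vector valued second fundamental form.\<close>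

lemma metric_trace_scaleR:
  assumes "subspace W" "\<And>e. e \<in> W \<Longrightarrow> b e e = a e e *\<^sub>R c"
  shows "metric_trace h W b = metric_trace h W a *\<^sub>R c"
  using trace_basis_subset[OF assms(1)] assms(2)
  by (simp add: metric_trace_eq scaleR_sum_left subset_iff)

end

section \<open>The Hessian of a function with respect to a connection\<close>

locale smooth_manifold_connection = smooth_manifold A
  for A :: "('x::{t2_space,second_countable_topology}, 'e::euclidean_space) atlas" +
  fixes nabla :: "'x \<Rightarrow> 'e \<Rightarrow> ('x \<Rightarrow> 'e) \<Rightarrow> 'e"
  assumes connection: "affine_connection A nabla"
begin

lemmas connection_properties = connection[unfolded affine_connection_def]

lemmas nabla_cong = connection_properties[THEN conjunct2, THEN conjunct1, rule_format]
lemmas nabla_add = connection_properties[THEN conjunct2, THEN conjunct2, THEN conjunct1, rule_format]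
lemmas nabla_scale =
  connection_properties[THEN conjunct2, THEN conjunct2, THEN conjunct2, THEN conjunct1, rule_format]

lemma nabla_sum:
  assumes "open U" "x \<in> U" "\<And>i. i \<in> I \<Longrightarrow> vf_smooth A U (W i)"
  shows "nabla x v (\<lambda>y. \<Sum>i\<in>I. W i y) = (\<Sum>i\<in>I. nabla x v (W i))"
proof -
  \<comment> \<open>The empty sum: the Leibniz rule with the constant function
    \<open>0\<close>.\<close>
  have zero: "nabla x v (\<lambda>y. 0) = 0"
    using nabla_scale[OF assms(1,2) fun_smooth_const[of U 0] vf_smooth_zero, of v] by simp
  from assms(3) show ?thesis
  proof (induction I rule: infinite_finite_induct)
    case (insert i I)
    then show ?case
      using nabla_add[OF assms(1,2) insert.prems vf_smooth_sum, of i I W v] by simp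
  qed (auto simp: zero)
qed

text \<open>The Hessian with an explicit field in its second slot, free of the choice of an
  extension made in \<open>hess\<close>.\<close>

definition hess_along :: "('x \<Rightarrow> real) \<Rightarrow> 'x \<Rightarrow> 'e \<Rightarrow> ('x \<Rightarrow> 'e) \<Rightarrow> real" where
  "hess_along f x v W = dir A x v (\<lambda>y. dir A y (W y) f) - dir A x (nabla x v W) f"

text \<open>Expanding \<open>W\<close> in coordinate fields, the terms in which \<open>v\<close>
  differentiates a coefficient occur both in \<open>v W f\<close> and in the derivative of
  \<open>f\<close> along \<open>nabla x v W\<close>, and cancel. Only the values of the coefficients
  at \<open>x\<close> remain, so the Hessian is tensorial.\<close>

lemma hess_along_expansion:
  assumes U: "open U" "x \<in> U" and W: "vf_smooth A U W" and f: "fun_smooth A U f"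
    and D: "(D, \<phi>) \<in> A" "x \<in> D"
  shows "hess_along f x v W =
    (\<Sum>b\<in>Basis. dir A x (W x) (\<lambda>z. \<phi> z \<bullet> b) * hess_along f x v (coord_field A D \<phi> b))"
proof -
  let ?V = "U \<inter> D"
  let ?E = "coord_field A D \<phi>"
  define a where "a b y = dir A y (W y) (\<lambda>z. \<phi> z \<bullet> b)" for b y
  have V: "open ?V" "x \<in> ?V" using U D chart_open by auto
  have a: "fun_smooth A ?V (a b)" for b
    unfolding a_def
    by (rule vf_smoothD[OF W V(1) _ fun_smooth_subset[OF chart_coord_smooth[OF D(1)]]]) auto
  have E: "vf_smooth A ?V (?E b)" for b
    using vf_smooth_subset[OF coord_field_smooth[OF D(1)]] by blast
  have fV: "fun_smooth A ?V f" using fun_smooth_subset[OF f] by blast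
  have Ef: "fun_smooth A ?V (\<lambda>y. dir A y (?E b y) f)" for b
    using vf_smoothD[OF E V(1) subset_refl fV] .
  have aE: "vf_smooth A ?V (\<lambda>y. a b y *\<^sub>R ?E b y)" for b
    using vf_smooth_scale[OF V(1) a E] .
  have W_eq: "W y = (\<Sum>b\<in>Basis. a b y *\<^sub>R ?E b y)" if "y \<in> ?V" for y
    unfolding a_def using coord_field_expansion[OF D(1)] that by blast
  have "nabla x v W = nabla x v (\<lambda>y. \<Sum>b\<in>Basis. a b y *\<^sub>R ?E b y)"
    by (rule nabla_cong[OF V vf_smooth_subset[OF W] vf_smooth_sum[OF aE] W_eq]) auto
  also have "\<dots> = (\<Sum>b\<in>Basis. nabla x v (\<lambda>y. a b y *\<^sub>R ?E b y))"
    by (rule nabla_sum[OF V aE])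
  also have "\<dots> = (\<Sum>b\<in>Basis. dir A x v (a b) *\<^sub>R ?E b x + a b x *\<^sub>R nabla x v (?E b))"
    by (intro sum.cong refl nabla_scale[OF V a E])
  finally have "dir A x (nabla x v W) f =
      (\<Sum>b\<in>Basis. dir A x v (a b) * dir A x (?E b x) f + a b x * dir A x (nabla x v (?E b)) f)"
    by (simp add: linear_sum[OF dir_linear[OF V(2) fV]] linear_add[OF dir_linear[OF V(2) fV]]
        linear_scale[OF dir_linear[OF V(2) fV]])
  moreover have "dir A x v (\<lambda>y. dir A y (W y) f) =
      dir A x v (\<lambda>y. \<Sum>b\<in>Basis. a b y * dir A y (?E b y) f)"
  proof (rule dir_cong[OF V vf_smoothD[OF vf_smooth_subset[OF W] V(1) subset_refl fV]])
    fix y assume y: "y \<in> ?V"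
    show "dir A y (W y) f = (\<Sum>b\<in>Basis. a b y * dir A y (?E b y) f)"
      unfolding W_eq[OF y] by (simp add: linear_sum[OF dir_linear[OF y fV]] linear_scale[OF dir_linear[OF y fV]])
  qed auto
  moreover have "\<dots> = (\<Sum>b\<in>Basis. dir A x v (\<lambda>y. a b y * dir A y (?E b y) f))"
    by (rule dir_sum[OF V fun_smooth_mult[OF V(1) a Ef]])
  moreover have "\<dots> = (\<Sum>b\<in>Basis. dir A x v (a b) * dir A x (?E b x) f +
      a b x * dir A x v (\<lambda>y. dir A y (?E b y) f))"
    by (intro sum.cong refl dir_mult[OF V(2) a Ef])
  ultimately have "hess_along f x v W = (\<Sum>b\<in>Basis. a b x * hess_along f x v (?E b))"
    by (simp add: hess_along_def sum_subtractf[symmetric] algebra_simps)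
  then show ?thesis by (simp add: a_def)
qed

text \<open>The expansion sees a field only through its value at \<open>x\<close>, so the extension
  chosen in \<open>hess\<close> may be exchanged for any other, in particular for a tangential
  one.\<close>

lemma hess_eq:
  assumes U: "open U" "x \<in> U" and W: "vf_smooth A U W" and f: "fun_smooth A U f"
  shows "hess A nabla f x v (W x) = hess_along f x v W"
proof -
  obtain D \<phi> where D: "(D, \<phi>) \<in> A" "x \<in> D" using chart_at by metis
  define W' where "W' = (SOME W'. (\<exists>U. open U \<and> x \<in> U \<and> vf_smooth A U W') \<and> W' x = W x)"
  have "\<exists>W'. (\<exists>U. open U \<and> x \<in> U \<and> vf_smooth A U W') \<and> W' x = W x" using U W by blast
  then have "(\<exists>U. open U \<and> x \<in> U \<and> vf_smooth A U W') \<and> W' x = W x"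
    unfolding W'_def by (rule someI_ex)
  then obtain U' where U': "open U'" "x \<in> U'" "vf_smooth A U' W'" "W' x = W x" by blast
  have "hess_along f x v W' = hess_along f x v W"
    using hess_along_expansion[of "U \<inter> U'" x W' f D \<phi> v] hess_along_expansion[OF U W f D, of v]
      U U' D vf_smooth_subset[OF U'(3)] fun_smooth_subset[OF f] open_Int[OF U(1) U'(1)] by simp
  then show ?thesis by (simp add: hess_def hess_along_def W'_def)
qed

end

section \<open>Gradients and defining functions with respect to the metric\<close>

locale riemannian_connection = smooth_manifold_connection A nabla
  for A :: "('x::{t2_space,second_countable_topology}, 'e::euclidean_space) atlas"
    and nabla :: "'x \<Rightarrow> 'e \<Rightarrow> ('x \<Rightarrow> 'e) \<Rightarrow> 'e" +
  fixes g :: "'x \<Rightarrow> 'e \<Rightarrow> 'e \<Rightarrow> real"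
  assumes metric: "inner_product_form (g x)"
begin

lemma gradient_inner:
  assumes "x \<in> U" "fun_smooth A U f"
  shows "g x (gradient A g f x) v = dir A x v f"
proof -
  interpret inner_product_form "g x" by (rule metric)
  have "\<exists>!u. \<forall>v. g x u v = dir A x v f"
    using riesz_exists[OF dir_linear[OF assms]] riesz_unique by metis
  then have "\<forall>v. g x (gradient A g f x) v = dir A x v f"
    unfolding gradient_def by (rule theI')
  then show ?thesis by blast
qed

lemma gradient_nonzero_iff:
  assumes "x \<in> U" "fun_smooth A U f"
  shows "gradient A g f x \<noteq> 0 \<longleftrightarrow> (\<exists>v. dir A x v f \<noteq> 0)"
proof -
  interpret inner_product_form "g x" by (rule metric)
  show ?thesis
    using gradient_inner[OF assms] eq_zero_iff[of "gradient A g f x"] by (metis form_simps(5))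
qed

text \<open>A domain containing the closure contains all of the frontier, and a gradient vanishes
  exactly when the differential does. Thus everything proved for local defining functions applies to
  global ones.\<close>

lemma defining_function_iff:
  assumes "open \<Omega>"
  shows "defining_function A g \<Omega> \<rho> \<longleftrightarrow> (\<exists>U. closure \<Omega> \<subseteq> U \<and> local_defining_function A \<Omega> U \<rho>)"
proof -
  have "open U \<and> closure \<Omega> \<subseteq> U \<and> fun_smooth A U \<rho> \<and> \<Omega> = {y\<in>U. \<rho> y < 0} \<and> (\<forall>y\<in>frontier \<Omega>. gradient A g \<rho> y \<noteq> 0)
      \<longleftrightarrow> closure \<Omega> \<subseteq> U \<and> local_defining_function A \<Omega> U \<rho>" for U
  proof (cases "closure \<Omega> \<subseteq> U \<and> fun_smooth A U \<rho>")
    case True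
    then have sub: "\<Omega> \<inter> U = \<Omega>" "frontier \<Omega> \<inter> U = frontier \<Omega>"
      using closure_subset[of \<Omega>] by (auto simp: frontier_def)
    have regular: "(\<forall>y\<in>frontier \<Omega>. gradient A g \<rho> y \<noteq> 0) \<longleftrightarrow> (\<forall>y\<in>frontier \<Omega>. \<exists>v. dir A y v \<rho> \<noteq> 0)"
      using True by (intro ball_cong refl gradient_nonzero_iff[of _ U]) (auto simp: frontier_def)
    show ?thesis
      unfolding local_defining_function_def sub regular by (intro iffI conjI; elim conjE; assumption)
  next
    case False
    then show ?thesis
      unfolding local_defining_function_def by (intro iffI; elim conjE; simp)
  qed
  then show ?thesis unfolding defining_function_def by (rule ex_cong1)
qed

definition grad_norm :: "('x \<Rightarrow> real) \<Rightarrow> 'x \<Rightarrow> real" where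
  "grad_norm f x = sqrt (g x (gradient A g f x) (gradient A g f x))"

section \<open>The normal, tangential fields and the second fundamental form at a boundary
  point\<close>

context
  fixes \<Omega> U :: "'x set" and r :: "'x \<Rightarrow> real" and x :: 'x
  assumes \<Omega>: "open \<Omega>" and r: "local_defining_function A \<Omega> U r" and x: "x \<in> frontier \<Omega>" "x \<in> U"
begin

interpretation inner_product_form "g x" by (rule metric)

lemma local_defining_function_smooth: "open U" "fun_smooth A U r"
  using r unfolding local_defining_function_def by blast+

lemma grad_norm_pos: "grad_norm r x > 0"
proof -
  have "gradient A g r x \<noteq> 0"
    using gradient_nonzero_iff[OF x(2) local_defining_function_smooth(2)] r x unfolding local_defining_function_def by blast
  then show ?thesis by (simp add: grad_norm_def pos)
qed

text \<open>For uniqueness, the part of a candidate \<open>N\<close> orthogonal to the gradient is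
  tangent, hence orthogonal to \<open>N\<close> as well and therefore zero. Unit length then leaves
  two multiples of the gradient, separated by the outward condition.\<close>

lemma outward_normal_eq: "outward_normal A g \<Omega> x = (1 / grad_norm r x) *\<^sub>R gradient A g r x"
proof -
  let ?G = "gradient A g r x" and ?c = "grad_norm r x"
  note c = grad_norm_pos
  have cc: "?c * ?c = g x ?G ?G"
    using c by (simp add: grad_norm_def)
  have G: "g x ?G v = dir A x v r" for v using gradient_inner[OF x(2) local_defining_function_smooth(2)] .
  have T: "tangent_to A (frontier \<Omega>) x = {v. g x ?G v = 0}"
    using tangent_to_frontier[OF \<Omega> r x] by (simp add: G)
  show ?thesis
    unfolding outward_normal_def
  proof (rule the_equality)
    have "dir A x ((1 / ?c) *\<^sub>R ?G) r > 0"
      using c by (simp add: G[symmetric] form_simps cc[symmetric])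
    then show "g x ((1 / ?c) *\<^sub>R ?G) ((1 / ?c) *\<^sub>R ?G) = 1 \<and>
      (\<forall>v\<in>tangent_to A (frontier \<Omega>) x. g x ((1 / ?c) *\<^sub>R ?G) v = 0) \<and>
      (\<exists>U r. x \<in> U \<and> local_defining_function A \<Omega> U r \<and> dir A x ((1 / ?c) *\<^sub>R ?G) r > 0)"
      using c cc r x(2) by (auto simp: form_simps T)
  next
    fix N assume N: "g x N N = 1 \<and> (\<forall>v\<in>tangent_to A (frontier \<Omega>) x. g x N v = 0) \<and>
      (\<exists>U r. x \<in> U \<and> local_defining_function A \<Omega> U r \<and> dir A x N r > 0)"
    define k where "k = g x ?G N / (?c * ?c)"
    define u where "u = N - k *\<^sub>R ?G"
    have "g x ?G u = 0" using c by (simp add: u_def k_def form_simps cc[symmetric])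
    moreover from this have "g x N u = 0" using N T by blast
    moreover have "g x u u = g x N u - k * g x ?G u" by (subst (1) u_def) (simp add: form_simps)
    ultimately have "g x u u = 0" by simp
    then have N_eq: "N = k *\<^sub>R ?G" by (simp add: eq_zero_iff u_def)
    then have "(k * ?c)\<^sup>2 = 1"
      using N by (simp add: form_simps cc[symmetric] power2_eq_square mult_ac)
    \<comment> \<open>The candidate is outward for some other local defining function
      \<open>s\<close>; comparison with \<open>r\<close> yields only a weak inequality, which the
      unit length upgrades to the value 1.\<close>
    moreover have "k \<ge> 0"
    proof -
      obtain V s where "x \<in> V" "local_defining_function A \<Omega> V s" "dir A x N s > 0" using N by blast
      then have "dir A x N r \<ge> 0"
        using dir_nonneg_of_local_defining_functions[OF \<Omega> x(1) _ _ r x(2)] by blast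
      then show ?thesis using c by (simp add: k_def G)
    qed
    then have "k * ?c \<ge> 0" using c by simp
    ultimately have "k * ?c = 1" by (auto simp: power2_eq_1_iff)
    then have "k = 1 / ?c" using c by (simp add: field_simps)
    then show "N = (1 / ?c) *\<^sub>R ?G" using N_eq by simp
  qed
qed

lemma dir_defining_function: "dir A x v r = grad_norm r x * g x v (outward_normal A g \<Omega> x)"
  using grad_norm_pos gradient_inner[OF x(2) local_defining_function_smooth(2), of v] sym[of v]
  by (simp add: outward_normal_eq form_simps)

lemma outward_normal_unit: "g x (outward_normal A g \<Omega> x) (outward_normal A g \<Omega> x) = 1"
proof -
  have "g x (gradient A g r x) (gradient A g r x) = grad_norm r x * grad_norm r x"
    using grad_norm_pos by (simp add: grad_norm_def)
  then show ?thesis using grad_norm_pos by (simp add: outward_normal_eq form_simps)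
qed

lemma tangent_to_frontier_normal:
  "tangent_to A (frontier \<Omega>) x = {v. g x v (outward_normal A g \<Omega> x) = 0}"
  using tangent_to_frontier[OF \<Omega> r x] grad_norm_pos by (simp add: dir_defining_function)

text \<open>The difference \<open>d\<close> of two candidates is tangent; being a combination of
  normal vectors it is also orthogonal to itself, hence zero.\<close>

lemma normal_part_eq:
  "normal_part A g \<Omega> x u = g x u (outward_normal A g \<Omega> x) *\<^sub>R outward_normal A g \<Omega> x"
proof -
  let ?N = "outward_normal A g \<Omega> x"
  show ?thesis
    unfolding normal_part_def tangent_to_frontier_normal
  proof (rule the_equality)
    show "(\<forall>v\<in>{v. g x v ?N = 0}. g x (g x u ?N *\<^sub>R ?N) v = 0) \<and> u - g x u ?N *\<^sub>R ?N \<in> {v. g x v ?N = 0}"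
      using outward_normal_unit by (auto simp: form_simps sym)
  next
    fix \<nu> assume \<nu>: "(\<forall>v\<in>{v. g x v ?N = 0}. g x \<nu> v = 0) \<and> u - \<nu> \<in> {v. g x v ?N = 0}"
    define d where "d = \<nu> - g x u ?N *\<^sub>R ?N"
    have d: "g x d ?N = 0" using \<nu> outward_normal_unit by (simp add: d_def form_simps)
    then have "g x \<nu> d = 0" using \<nu> by blast
    moreover have "g x ?N d = 0" using d sym by simp
    moreover have "g x d d = g x \<nu> d - g x u ?N * g x ?N d"
      by (subst (1) d_def) (simp add: form_simps)
    ultimately have "g x d d = 0" by simp
    then show "\<nu> = g x u ?N *\<^sub>R ?N" by (simp add: eq_zero_iff d_def)
  qed
qed

text \<open>With a direction \<open>u\<close> transverse to the boundary, the combination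
  \<open>(E_u r) E_w - (E_w r) E_u\<close> of coordinate fields annihilates \<open>r\<close>
  identically near \<open>x\<close>. At \<open>x\<close> the second term is zero because
  \<open>w\<close> is tangent, and division by \<open>k\<close> normalizes the first to
  \<open>w\<close>.\<close>

lemma tangential_extension_exists:
  assumes w: "w \<in> tangent_to A (frontier \<Omega>) x"
  shows "\<exists>W. (\<exists>V. open V \<and> x \<in> V \<and> vf_smooth A V W \<and>
    (\<forall>y\<in>V \<inter> frontier \<Omega>. W y \<in> tangent_to A (frontier \<Omega>) y)) \<and> W x = w"
proof -
  obtain D \<phi> where D: "chart_at A x = (D, \<phi>)" "(D, \<phi>) \<in> A" "x \<in> D" using chart_at .
  obtain u where u: "dir A x u r > 0" using local_defining_function_dir_pos[OF r x] .
  let ?V = "U \<inter> D" and ?E = "coord_field A D \<phi>"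
  define k where "k = dir A x u r"
  define e where "e b y = dir A y (?E b y) r" for b y
  define W where "W y = (e u y * (1 / k)) *\<^sub>R ?E w y + (e w y * (- 1 / k)) *\<^sub>R ?E u y" for y
  have V: "open ?V" "x \<in> ?V" using local_defining_function_smooth x D chart_open by auto
  have rV: "fun_smooth A ?V r" using fun_smooth_subset[OF local_defining_function_smooth(2)] by blast
  have E: "vf_smooth A ?V (?E b)" for b
    using vf_smooth_subset[OF coord_field_smooth[OF D(2)]] by blast
  have e: "fun_smooth A ?V (e b)" for b
    unfolding e_def using vf_smoothD[OF E V(1) subset_refl rV] .
  have "vf_smooth A ?V W"
    unfolding W_def
    by (intro vf_smooth_add vf_smooth_scale fun_smooth_mult fun_smooth_const e E V(1))
  moreover have "W x = w"
    using tangent_to_frontier[OF \<Omega> r x] w u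
    by (simp add: W_def e_def k_def coord_field_chart_at[OF D(1)])
  moreover have "W y \<in> tangent_to A (frontier \<Omega>) y" if y: "y \<in> ?V \<inter> frontier \<Omega>" for y
  proof -
    have L: "linear (\<lambda>v. dir A y v r)" using dir_linear[of y ?V r] rV y by blast
    have "dir A y (W y) r = e u y * (1 / k) * e w y + e w y * (- 1 / k) * e u y"
      unfolding W_def linear_add[OF L] linear_scale[OF L] by (simp add: e_def)
    then have "dir A y (W y) r = 0" by simp
    then show ?thesis using tangent_to_frontier[OF \<Omega> r, of y] y by blast
  qed
  ultimately show ?thesis using V by blast
qed

text \<open>A tangential field \<open>W\<close> satisfies \<open>W r = 0\<close> along the boundary, so that only
  \<open>- (\<nabla>\<^sub>v W) r\<close> remains of the Hessian.\<close>

lemma hess_eq_second_fund: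
  assumes "v \<in> tangent_to A (frontier \<Omega>) x" "w \<in> tangent_to A (frontier \<Omega>) x"
  shows "hess A nabla r x v w = - grad_norm r x * second_fund A g nabla \<Omega> x v w"
proof -
  define W where "W = tangential_extension A \<Omega> x w"
  have "(\<exists>V. open V \<and> x \<in> V \<and> vf_smooth A V W \<and>
    (\<forall>y\<in>V \<inter> frontier \<Omega>. W y \<in> tangent_to A (frontier \<Omega>) y)) \<and> W x = w"
    unfolding W_def tangential_extension_def by (rule someI_ex[OF tangential_extension_exists[OF assms(2)]])
  then obtain V where V: "open V" "x \<in> V" "vf_smooth A V W"
    "\<And>y. y \<in> V \<Longrightarrow> y \<in> frontier \<Omega> \<Longrightarrow> W y \<in> tangent_to A (frontier \<Omega>) y" and Wx: "W x = w" by blast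
  let ?V = "U \<inter> V"
  have o: "open ?V" "x \<in> ?V" using local_defining_function_smooth V x by auto
  have rV: "fun_smooth A ?V r" and WV: "vf_smooth A ?V W"
    using fun_smooth_subset[OF local_defining_function_smooth(2)] vf_smooth_subset[OF V(3)] by blast+
  have "dir A y (W y) r = 0" if "y \<in> ?V" "y \<in> frontier \<Omega>" for y
    using V(4)[of y] tangent_to_frontier[OF \<Omega> r, of y] that by blast
  moreover have "fun_smooth A ?V (\<lambda>y. dir A y (W y) r)"
    using vf_smoothD[OF WV o(1) subset_refl rV] .
  ultimately have "dir A x v (\<lambda>y. dir A y (W y) r) = 0"
    using assms(1) o unfolding tangent_to_def by blast
  then have "hess A nabla r x v w = - dir A x (nabla x v W) r"
    using hess_eq[OF o WV rV, of v] Wx by (simp add: hess_along_def)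
  then show ?thesis by (simp add: dir_defining_function second_fund_def W_def)
qed

lemma second_fund_vec_eq:
  "second_fund_vec A g nabla \<Omega> x v w = second_fund A g nabla \<Omega> x v w *\<^sub>R outward_normal A g \<Omega> x"
  by (simp add: second_fund_vec_def second_fund_def normal_part_eq)

lemma metric_trace_hess:
  assumes "subspace W" "W \<subseteq> tangent_to A (frontier \<Omega>) x"
  shows "metric_trace (g x) W (hess A nabla r x) =
    - grad_norm r x * metric_trace (g x) W (second_fund A g nabla \<Omega> x)"
  using metric_trace_scaleR[OF assms(1), of "hess A nabla r x" "second_fund A g nabla \<Omega> x" "- grad_norm r x"]
    hess_eq_second_fund assms(2) by (auto simp: subset_iff)

lemma metric_trace_second_fund_vec:
  assumes "subspace W"
  shows "metric_trace (g x) W (second_fund_vec A g nabla \<Omega> x) =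
    metric_trace (g x) W (second_fund A g nabla \<Omega> x) *\<^sub>R outward_normal A g \<Omega> x"
  by (rule metric_trace_scaleR[OF assms second_fund_vec_eq])

lemma inward_pointing_iff: "inward_pointing A g \<Omega> x (t *\<^sub>R outward_normal A g \<Omega> x) \<longleftrightarrow> t \<le> 0"
proof -
  have "outward_normal A g \<Omega> x \<noteq> 0" using outward_normal_unit eq_zero_iff[of "outward_normal A g \<Omega> x"] by auto
  moreover have "c *\<^sub>R (- outward_normal A g \<Omega> x) = (- c) *\<^sub>R outward_normal A g \<Omega> x" for c by simp
  ultimately show ?thesis
    unfolding inward_pointing_def by (auto simp only: scaleR_cancel_right intro: exI[of _ "- t"])
qed

end

end

text \<open>Symmetry comes from moving \<open>J\<close> across: invariance and \<open>J\<close>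
  squared being minus the identity give \<open>\<omega>(Ju,v) = -\<omega>(u,Jv)\<close>, which
  equals \<open>\<omega>(Jv,u)\<close> by antisymmetry.\<close>

lemma gromov_metric_inner_product_form:
  assumes "gromov_manifold A \<omega> J"
  shows "inner_product_form (gromov_metric \<omega> J x)"
proof
  note gm = assms[unfolded gromov_manifold_def, THEN conjunct2]
  note sf = gm[THEN conjunct1, unfolded symplectic_form_def, THEN conjunct1, rule_format]
  note ac = gm[THEN conjunct2, THEN conjunct1, unfolded almost_complex_def, THEN conjunct1, rule_format]
  note invariant = gm[THEN conjunct2, THEN conjunct2, THEN conjunct1, rule_format]
  note pos = gm[THEN conjunct2, THEN conjunct2, THEN conjunct2, rule_format]
  have \<omega>: "bilinear (\<omega> x)" "\<omega> x v v = 0" for v using sf[of x] by blast+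
  have J: "linear (J x)" "J x (J x v) = - v" for v using ac[of x] by blast+
  show "bilinear (gromov_metric \<omega> J x)"
    using \<omega>(1) linear_compose[OF J(1), of "\<lambda>u. \<omega> x u _"]
    by (auto simp: bilinear_def gromov_metric_def comp_def)
  have alt: "\<omega> x u v = - \<omega> x v u" for u v
    using \<omega>(2)[of "u + v"] \<omega>(2)[of u] \<omega>(2)[of v]
    by (simp add: bilinear_ladd[OF \<omega>(1)] bilinear_radd[OF \<omega>(1)])
  fix u v
  have "\<omega> x (J x u) v = - \<omega> x u (J x v)"
    using invariant[of x "J x u" v] by (simp add: J(2) bilinear_lneg[OF \<omega>(1)])
  then show "gromov_metric \<omega> J x u v = gromov_metric \<omega> J x v u"
    using alt[of u "J x v"] by (simp add: gromov_metric_def)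
  show "u \<noteq> 0 \<Longrightarrow> gromov_metric \<omega> J x u u > 0"
    by (simp add: gromov_metric_def pos)
qed

theorem proposition10p9:
  fixes A :: "('x::{t2_space,second_countable_topology}, 'e::euclidean_space) atlas"
    and \<omega> :: "'x \<Rightarrow> 'e \<Rightarrow> 'e \<Rightarrow> real"
    and J :: "'x \<Rightarrow> 'e \<Rightarrow> 'e"
    and g :: "'x \<Rightarrow> 'e \<Rightarrow> 'e \<Rightarrow> real"
    and nabla :: "'x \<Rightarrow> 'e \<Rightarrow> ('x \<Rightarrow> 'e) \<Rightarrow> 'e"
    and \<Omega> :: "'x set"
    and n :: nat
  assumes "gromov_manifold A \<omega> J"
    and "DIM('e) = 2 * n"
    and "g = gromov_metric \<omega> J"
    and "levi_civita A g nabla"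
    and "\<not> compact (UNIV :: 'x set)"
    and "open \<Omega>" and "connected \<Omega>" and "\<Omega> \<noteq> {}"
    and "compact (closure \<Omega>)"
    and "smooth_boundary A \<Omega>"
  shows
    "(lagrangian_convex A \<omega> J nabla n \<Omega> \<longleftrightarrow>
        (\<forall>(x, W)\<in>LAG A \<omega> n \<Omega>. metric_trace (g x) W (second_fund A g nabla \<Omega> x) \<le> 0))
     \<and> (lagrangian_convex A \<omega> J nabla n \<Omega> \<longleftrightarrow>
        (\<forall>(x, W)\<in>LAG A \<omega> n \<Omega>.
           inward_pointing A g \<Omega> x (metric_trace (g x) W (second_fund_vec A g nabla \<Omega> x))))
     \<and> (strictly_lagrangian_convex A \<omega> J nabla n \<Omega> \<longleftrightarrow>
        (\<forall>(x, W)\<in>LAG A \<omega> n \<Omega>. metric_trace (g x) W (second_fund A g nabla \<Omega> x) < 0))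
     \<and> (strictly_lagrangian_convex A \<omega> J nabla n \<Omega> \<longleftrightarrow>
        (\<forall>(x, W)\<in>LAG A \<omega> n \<Omega>.
           metric_trace (g x) W (second_fund_vec A g nabla \<Omega> x) \<noteq> 0 \<and>
           inward_pointing A g \<Omega> x (metric_trace (g x) W (second_fund_vec A g nabla \<Omega> x))))"
proof -
  interpret riemannian_connection A nabla g
  proof (intro riemannian_connection.intro smooth_manifold_connection.intro smooth_manifold.intro
      smooth_manifold_connection_axioms.intro riemannian_connection_axioms.intro)
    show "smooth_atlas A" by (rule assms(1)[unfolded gromov_manifold_def, THEN conjunct1])
    show "affine_connection A nabla" by (rule assms(4)[unfolded levi_civita_def, THEN conjunct1])
    show "inner_product_form (g x)" for x
      unfolding assms(3) by (rule gromov_metric_inner_product_form[OF assms(1)])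
  qed
  let ?tr = "\<lambda>x W. metric_trace (g x) W (second_fund A g nabla \<Omega> x)"
  have LAG: "x \<in> frontier \<Omega>" "subspace W" "W \<subseteq> tangent_to A (frontier \<Omega>) x"
    if "(x, W) \<in> LAG A \<omega> n \<Omega>" for x W
    using that by (auto simp: LAG_def lagrangian_plane_def)
  obtain U \<rho> where U: "closure \<Omega> \<subseteq> U" "local_defining_function A \<Omega> U \<rho>"
    using defining_function_exists[OF assms(6,9,10)] .
  then have \<rho>: "defining_function A g \<Omega> \<rho>" using defining_function_iff[OF assms(6)] by blast
  have sign: "metric_trace (g x) W (hess A nabla r x) \<ge> 0 \<longleftrightarrow> ?tr x W \<le> 0"
    "metric_trace (g x) W (hess A nabla r x) > 0 \<longleftrightarrow> ?tr x W < 0"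
    if r: "defining_function A g \<Omega> r" and W: "(x, W) \<in> LAG A \<omega> n \<Omega>" for r x W
  proof -
    obtain V where V: "closure \<Omega> \<subseteq> V" "local_defining_function A \<Omega> V r"
      using r defining_function_iff[OF assms(6)] by blast
    then have x: "x \<in> V" using LAG(1)[OF W] by (auto simp: frontier_def)
    note ctx = assms(6) V(2) LAG(1)[OF W] x
    show "metric_trace (g x) W (hess A nabla r x) \<ge> 0 \<longleftrightarrow> ?tr x W \<le> 0"
      "metric_trace (g x) W (hess A nabla r x) > 0 \<longleftrightarrow> ?tr x W < 0"
      using metric_trace_hess[OF ctx LAG(2,3)[OF W]] grad_norm_pos[OF ctx]
      by (simp_all add: mult_le_0_iff mult_less_0_iff)
  qed
  \<comment> \<open>From left to right \<open>sign\<close> is applied to the unknown witness of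
    convexity, from right to left to the constructed \<open>\<rho>\<close>.\<close>
  have convex: "lagrangian_convex A \<omega> J nabla n \<Omega> \<longleftrightarrow> (\<forall>(x, W)\<in>LAG A \<omega> n \<Omega>. ?tr x W \<le> 0)"
    unfolding lagrangian_convex_def assms(3)[symmetric] using sign(1) \<rho> by fast
  have strict: "strictly_lagrangian_convex A \<omega> J nabla n \<Omega> \<longleftrightarrow> (\<forall>(x, W)\<in>LAG A \<omega> n \<Omega>. ?tr x W < 0)"
    unfolding strictly_lagrangian_convex_def assms(3)[symmetric] using sign(2) \<rho> by fast
  have vec: "inward_pointing A g \<Omega> x (metric_trace (g x) W (second_fund_vec A g nabla \<Omega> x)) \<longleftrightarrow> ?tr x W \<le> 0"
    "metric_trace (g x) W (second_fund_vec A g nabla \<Omega> x) = 0 \<longleftrightarrow> ?tr x W = 0"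
    if W: "(x, W) \<in> LAG A \<omega> n \<Omega>" for x W
  proof -
    have "x \<in> U" using U(1) LAG(1)[OF W] by (auto simp: frontier_def)
    note ctx = assms(6) U(2) LAG(1)[OF W] this
    show "inward_pointing A g \<Omega> x (metric_trace (g x) W (second_fund_vec A g nabla \<Omega> x)) \<longleftrightarrow> ?tr x W \<le> 0"
      using metric_trace_second_fund_vec[OF ctx LAG(2)[OF W]] inward_pointing_iff[OF ctx] by simp
    have "outward_normal A g \<Omega> x \<noteq> 0"
      using outward_normal_unit[OF ctx] inner_product_form.eq_zero_iff[OF metric, of x "outward_normal A g \<Omega> x"]
      by auto
    then show "metric_trace (g x) W (second_fund_vec A g nabla \<Omega> x) = 0 \<longleftrightarrow> ?tr x W = 0"
      using metric_trace_second_fund_vec[OF ctx LAG(2)[OF W]] by simp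
  qed
  show ?thesis
    unfolding convex strict using vec by (auto simp: less_le)
qed

end
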